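(* Let $\Psi\subset\mathrm{Int}\,\mathbb{A}$ be an essential cofrontier and let $h:C\to C$ be a minimal homeomorphism of a Cantor set $C$. Then the pseudo-suspension $\Psi_C$ of $h$ is a continuum. If additionally $\Psi$ is the pseudo-circle, then every proper subcontinuum of $\Psi_C$ is a pseudo-arc and consequently $\Psi_C$ is hereditarily indecomposable.
   Context: $\mathbb{A}=[0,1]\times\mathbb{R}/\mathbb{Z}$ with universal covering $q:[0,1]\times\mathbb{R}\to\mathbb{A}$, $q(s,r)=(s,r+\mathbb{Z})$. A cofrontier is a planar continuum whose complement is the union of two connected open sets, each having the continuum as its boundary; $\Psi\subset\mathrm{Int}\,\mathbb{A}$ is essential if $\mathbb{A}\setminus\Psi$ has two components each containing a different boundary component of $\mathbb{A}$. Let $([0,1]\times\mathbb{R})_C$ be the quotient of $[0,1]\times\mathbb{R}\times C$ by the relation $((s,r),c)\approx((s',r'),c')$ iff $s=s'$ and there is $n\in\mathbb{Z}$ with $r'=r+n$ and $c'=h^{-n}(c)$, and let $q_C:([0,1]\times\mathbb{R})_C\to\mathbb{A}$ be $q_C([(s,r),c])=q(s,r)$. The pseudo-suspension of $h$ is $\Psi_C=q_C^{-1}(\Psi)$. A proper subcontinuum is a subcontinuum that is neither the whole space nor a single point. The pseudo-circle is Bing's hereditarily indecomposable circularly chainable planar continuum; the pseudo-arc is the chainable hereditarily indecomposable continuum. *)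

theory Defs
  imports "HOL-Analysis.Analysis"
begin

definition continuum_space :: "'a topology \<Rightarrow> bool" where
  "continuum_space X \<longleftrightarrow> topspace X \<noteq> {} \<and> compact_space X \<and> connected_space X
     \<and> metrizable_space X"

definition subcontinuum :: "'a topology \<Rightarrow> 'a set \<Rightarrow> bool" where
  "subcontinuum X K \<longleftrightarrow> K \<subseteq> topspace X \<and> continuum_space (subtopology X K)"

definition proper_subcontinuum :: "'a topology \<Rightarrow> 'a set \<Rightarrow> bool" where
  "proper_subcontinuum X K \<longleftrightarrow> subcontinuum X K \<and> K \<noteq> topspace X \<and> (\<nexists>x. K = {x})"

definition indecomposable_space :: "'a topology \<Rightarrow> bool" where
  "indecomposable_space X \<longleftrightarrow>
     \<not> (\<exists>A B. proper_subcontinuum X A \<and> proper_subcontinuum X B \<and> A \<union> B = topspace X)"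

definition hereditarily_indecomposable :: "'a topology \<Rightarrow> bool" where
  "hereditarily_indecomposable X \<longleftrightarrow>
     continuum_space X \<and>
     (\<forall>K. subcontinuum X K \<longrightarrow> indecomposable_space (subtopology X K))"

definition is_chain :: "'a topology \<Rightarrow> 'a set list \<Rightarrow> bool" where
  "is_chain X L \<longleftrightarrow> L \<noteq> [] \<and> (\<forall>U\<in>set L. openin X U) \<and> topspace X \<subseteq> \<Union>(set L) \<and>
     (\<forall>i<length L. \<forall>j<length L. (L!i \<inter> L!j \<noteq> {}) \<longleftrightarrow> (i \<le> j + 1 \<and> j \<le> i + 1))"

definition is_circular_chain :: "'a topology \<Rightarrow> 'a set list \<Rightarrow> bool" where
  "is_circular_chain X L \<longleftrightarrow> length L \<ge> 3 \<and> (\<forall>U\<in>set L. openin X U) \<and> topspace X \<subseteq> \<Union>(set L) \<and>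
     (\<forall>i<length L. \<forall>j<length L. (L!i \<inter> L!j \<noteq> {}) \<longleftrightarrow>
        (i \<le> j + 1 \<and> j \<le> i + 1) \<or> (i = 0 \<and> j = length L - 1) \<or> (j = 0 \<and> i = length L - 1))"

definition refines :: "'a set list \<Rightarrow> 'a set set \<Rightarrow> bool" where
  "refines L \<U> \<longleftrightarrow> (\<forall>V\<in>set L. \<exists>U\<in>\<U>. V \<subseteq> U)"

definition chainable :: "'a topology \<Rightarrow> bool" where
  "chainable X \<longleftrightarrow> (\<forall>\<U>. (\<forall>U\<in>\<U>. openin X U) \<and> topspace X \<subseteq> \<Union>\<U> \<longrightarrow>
      (\<exists>L. is_chain X L \<and> refines L \<U>))"

definition circularly_chainable :: "'a topology \<Rightarrow> bool" where
  "circularly_chainable X \<longleftrightarrow> (\<forall>\<U>. (\<forall>U\<in>\<U>. openin X U) \<and> topspace X \<subseteq> \<Union>\<U> \<longrightarrow>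
      (\<exists>L. is_circular_chain X L \<and> refines L \<U>))"

text \<open>The pseudo-arc: the (unique, by Bing) nondegenerate chainable hereditarily
  indecomposable continuum.\<close>
definition pseudo_arc :: "'a topology \<Rightarrow> bool" where
  "pseudo_arc X \<longleftrightarrow> continuum_space X \<and> (\<exists>x y. x \<in> topspace X \<and> y \<in> topspace X \<and> x \<noteq> y)
     \<and> chainable X \<and> hereditarily_indecomposable X"

text \<open>The pseudo-circle: Bing's planar circularly chainable hereditarily indecomposable
  continuum separating the plane (unique up to homeomorphism, Fearnley / Rogers).\<close>
definition pseudo_circle :: "'a topology \<Rightarrow> bool" where
  "pseudo_circle X \<longleftrightarrow> (\<exists>S :: complex set. compact S \<and> \<not> connected (- S) \<and>
      circularly_chainable (top_of_set S) \<and> hereditarily_indecomposable (top_of_set S) \<and>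
      X homeomorphic_space top_of_set S)"

definition cofrontier :: "complex set \<Rightarrow> bool" where
  "cofrontier K \<longleftrightarrow> K \<noteq> {} \<and> compact K \<and> connected K \<and>
     (\<exists>U V. open U \<and> open V \<and> connected U \<and> connected V \<and> U \<inter> V = {} \<and>
        U \<union> V = - K \<and> frontier U = K \<and> frontier V = K)"

text \<open>The annulus \<open>[0,1] \<times> \<real>/\<int>\<close> is realised in the plane via the homeomorphism
  \<open>(s, r + \<int>) \<mapsto> (1+s) e^{2\<pi> i r}\<close>, i.e. as \<open>{z. 1 \<le> |z| \<le> 2}\<close>.
  The covering map \<open>q\<close> then becomes \<open>q(s,r) = (1+s) e^{2\<pi> i r}\<close>.\<close>
definition annulus :: "complex set" where
  "annulus = {z. 1 \<le> cmod z \<and> cmod z \<le> 2}"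

definition annulus_interior :: "complex set" where
  "annulus_interior = {z. 1 < cmod z \<and> cmod z < 2}"

definition qcov :: "real \<times> real \<Rightarrow> complex" where
  "qcov p = complex_of_real (1 + fst p) * cis (2 * pi * snd p)"

definition essential :: "complex set \<Rightarrow> bool" where
  "essential K \<longleftrightarrow> K \<subseteq> annulus_interior \<and>
     (\<exists>C1 C2. components (annulus - K) = {C1, C2} \<and> C1 \<noteq> C2 \<and>
        sphere 0 1 \<subseteq> C1 \<and> sphere 0 2 \<subseteq> C2)"

definition cantor_ternary :: "real set" where
  "cantor_ternary = {x. \<exists>d :: nat \<Rightarrow> nat. (\<forall>n. d n = 0 \<or> d n = 2) \<and>
       (\<lambda>n. real (d n) / 3 ^ Suc n) sums x}"

definition cantor_space :: "'a topology \<Rightarrow> bool" where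
  "cantor_space X \<longleftrightarrow> X homeomorphic_space top_of_set cantor_ternary"

definition minimal_homeomorphism :: "'a topology \<Rightarrow> ('a \<Rightarrow> 'a) \<Rightarrow> bool" where
  "minimal_homeomorphism X h \<longleftrightarrow> homeomorphic_map X X h \<and>
     (\<forall>K. closedin X K \<and> K \<noteq> {} \<and> h ` K = K \<longrightarrow> K = topspace X)"

definition hpow :: "'a topology \<Rightarrow> ('a \<Rightarrow> 'a) \<Rightarrow> int \<Rightarrow> 'a \<Rightarrow> 'a" where
  "hpow X h n = (if 0 \<le> n then h ^^ nat n else inv_into (topspace X) h ^^ nat (- n))"

definition quotient_topology :: "'a topology \<Rightarrow> ('a \<Rightarrow> 'b) \<Rightarrow> 'b topology" where
  "quotient_topology P f =
     topology (\<lambda>U. U \<subseteq> f ` topspace P \<and> openin P {x \<in> topspace P. f x \<in> U})"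

lemma istopology_quotient:
  fixes P :: "'a topology" and f :: "'a \<Rightarrow> 'b"
  shows "istopology (\<lambda>U. U \<subseteq> f ` topspace P \<and> openin P {x \<in> topspace P. f x \<in> U})"
  unfolding istopology_def
proof (rule conjI)
  show "\<forall>S T. S \<subseteq> f ` topspace P \<and> openin P {x \<in> topspace P. f x \<in> S} \<longrightarrow>
     T \<subseteq> f ` topspace P \<and> openin P {x \<in> topspace P. f x \<in> T} \<longrightarrow>
     S \<inter> T \<subseteq> f ` topspace P \<and> openin P {x \<in> topspace P. f x \<in> S \<inter> T}"
  proof (intro allI impI)
    fix S T :: "'b set"
    assume S: "S \<subseteq> f ` topspace P \<and> openin P {x \<in> topspace P. f x \<in> S}"
       and T: "T \<subseteq> f ` topspace P \<and> openin P {x \<in> topspace P. f x \<in> T}"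
    have e: "{x \<in> topspace P. f x \<in> S \<inter> T} = {x \<in> topspace P. f x \<in> S} \<inter> {x \<in> topspace P. f x \<in> T}"
      by auto
    show "S \<inter> T \<subseteq> f ` topspace P \<and> openin P {x \<in> topspace P. f x \<in> S \<inter> T}"
      using S T unfolding e by auto
  qed
  show "\<forall>K. (\<forall>S\<in>K. S \<subseteq> f ` topspace P \<and> openin P {x \<in> topspace P. f x \<in> S}) \<longrightarrow>
     \<Union>K \<subseteq> f ` topspace P \<and> openin P {x \<in> topspace P. f x \<in> \<Union>K}"
  proof (intro allI impI)
    fix K :: "'b set set"
    assume K: "\<forall>S\<in>K. S \<subseteq> f ` topspace P \<and> openin P {x \<in> topspace P. f x \<in> S}"
    have e: "{x \<in> topspace P. f x \<in> \<Union>K} = (\<Union>S\<in>K. {x \<in> topspace P. f x \<in> S})" by auto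
    show "\<Union>K \<subseteq> f ` topspace P \<and> openin P {x \<in> topspace P. f x \<in> \<Union>K}"
      using K unfolding e by auto
  qed
qed

definition ps_rel :: "'c topology \<Rightarrow> ('c \<Rightarrow> 'c) \<Rightarrow> ((real \<times> real) \<times> 'c) \<Rightarrow> ((real \<times> real) \<times> 'c) \<Rightarrow> bool" where
  "ps_rel X h a b \<longleftrightarrow> fst (fst a) = fst (fst b) \<and>
     (\<exists>n::int. snd (fst b) = snd (fst a) + of_int n \<and> snd b = hpow X h (- n) (snd a))"

definition ps_domain :: "'c topology \<Rightarrow> ((real \<times> real) \<times> 'c) topology" where
  "ps_domain X = prod_topology (top_of_set ({0..1} \<times> UNIV)) X"

definition ps_class :: "'c topology \<Rightarrow> ('c \<Rightarrow> 'c) \<Rightarrow> ((real \<times> real) \<times> 'c) \<Rightarrow> ((real \<times> real) \<times> 'c) set" where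
  "ps_class X h a = {b \<in> topspace (ps_domain X). ps_rel X h a b}"

definition ps_space :: "'c topology \<Rightarrow> ('c \<Rightarrow> 'c) \<Rightarrow> ((real \<times> real) \<times> 'c) set topology" where
  "ps_space X h = quotient_topology (ps_domain X) (ps_class X h)"

definition qC :: "((real \<times> real) \<times> 'c) set \<Rightarrow> complex" where
  "qC E = qcov (fst (SOME a. a \<in> E))"

definition pseudo_suspension :: "'c topology \<Rightarrow> ('c \<Rightarrow> 'c) \<Rightarrow> complex set \<Rightarrow> ((real \<times> real) \<times> 'c) set set" where
  "pseudo_suspension X h K = {E \<in> topspace (ps_space X h). qC E \<in> K}"

end

theory Submission
  imports Defs
begin

text \<open>
  In logarithmic polar coordinates the covering map becomes \<open>exp\<close>, and \<open>\<Psi>\<^sub>C\<close> becomes the quotient of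
  \<open>exp -` \<Psi> \<times> C\<close> by a free action of the integers; it embeds as a compact subset \<open>M\<close> of a Euclidean
  space. The lift \<open>exp -` \<Psi>\<close> is connected since the plane is unicoherent: it is the intersection of the
  closures of the lifts of the two sides of \<open>\<Psi>\<close>. With minimality of \<open>h\<close> this makes \<open>M\<close> connected.

  Let \<open>K\<close> be a subcontinuum of \<open>M\<close> and \<open>Z \<times> {c}\<close> a component of its preimage. If \<open>Z\<close> is compact, then \<open>K\<close>
  is the image of \<open>Z \<times> {c}\<close>. If \<open>Z\<close> is unbounded, translates of \<open>Z\<close> accumulate on a leaf
  \<open>exp -` \<Psi> \<times> {c'}\<close>: otherwise a path through a gap would join the two sides of the strip without meeting
  them. That leaf is dense, so \<open>K = M\<close>.

  If \<open>\<Psi>\<close> is hereditarily indecomposable, \<open>exp\<close> is injective on every compact connected \<open>Z \<subseteq> exp -` \<Psi>\<close>, and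
  \<open>exp ` Z \<noteq> \<Psi>\<close> since \<open>\<Psi>\<close> carries no continuous logarithm. So each proper subcontinuum of \<open>M\<close> is
  homeomorphic to a proper subcontinuum of \<open>\<Psi>\<close>, which is chainable and hereditarily indecomposable.
\<close>

section \<open>Continua, chains and homeomorphisms\<close>

text \<open>\<Psi> need not contain any arc, so paths are taken only in open sets, where
  connectedness yields them, and \<Psi> is controlled as the common frontier of its two sides.
  Minimality enters only as density of every leaf: this makes \<open>M\<close> connected, and it
  also shows that a subcontinuum with an unbounded plaque is everything. Hereditary
  indecomposability is handled throughout as nestedness of overlapping subcontinua, because
  nestedness in \<Psi> can be carried back along \<open>exp\<close> by uniqueness of lifts. The
  abstract Cantor space is replaced by the ternary set in the real line, so that \<open>M\<close>
  lies in a metric space and arguments with closed sets, sequences and components are available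
  there.\<close>

lemma subcontinuum_iff:
  assumes "metrizable_space X"
  shows "subcontinuum X K \<longleftrightarrow> K \<noteq> {} \<and> compactin X K \<and> connectedin X K"
  unfolding subcontinuum_def continuum_space_def
  using assms metrizable_space_subtopology
  by (auto simp: compactin_subspace connectedin_def)

lemma subcontinuum_top_of_set:
  fixes S :: "'a::metric_space set"
  shows "subcontinuum (top_of_set S) K \<longleftrightarrow> K \<subseteq> S \<and> K \<noteq> {} \<and> compact K \<and> connected K"
  by (subst subcontinuum_iff)
     (auto simp: metrizable_space_subtopology metrizable_space_euclidean compactin_subtopology
        connectedin_subtopology)

lemma continuum_space_top_of_set:
  fixes S :: "'a::metric_space set"
  shows "continuum_space (top_of_set S) \<longleftrightarrow> S \<noteq> {} \<and> compact S \<and> connected S"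
  using compactin_subspace[of euclidean S]
  by (auto simp: continuum_space_def metrizable_space_subtopology metrizable_space_euclidean
      simp flip: connectedin_topspace)

lemma homeomorphic_continuum_space:
  assumes "X homeomorphic_space Y"
  shows "continuum_space X \<longleftrightarrow> continuum_space Y"
  unfolding continuum_space_def
  using homeomorphic_compact_space[OF assms] homeomorphic_connected_space[OF assms]
    homeomorphic_metrizable_space[OF assms] homeomorphic_empty_space[OF assms]
  by auto

lemma homeomorphic_map_subtopology_image:
  assumes "homeomorphic_map X Y f" "K \<subseteq> topspace X"
  shows "homeomorphic_map (subtopology X K) (subtopology Y (f ` K)) f"
proof (rule homeomorphic_map_subtopologies[OF assms(1)])
  have "f ` topspace X = topspace Y"
    using assms(1) by (simp add: homeomorphic_imp_surjective_map)
  then show "f ` (topspace X \<inter> K) = topspace Y \<inter> f ` K" using assms(2) by blast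
qed

lemma subcontinuum_homeomorphic_image:
  assumes "homeomorphic_map X Y f" "subcontinuum X K"
  shows "subcontinuum Y (f ` K)"
proof -
  have K: "K \<subseteq> topspace X" and "continuum_space (subtopology X K)"
    using assms(2) by (auto simp: subcontinuum_def)
  moreover have "f ` K \<subseteq> topspace Y"
    using K homeomorphic_imp_surjective_map[OF assms(1)] by blast
  ultimately show ?thesis
    using homeomorphic_map_subtopology_image[OF assms(1) K] homeomorphic_continuum_space
    by (metis homeomorphic_map_imp_homeomorphic_space subcontinuum_def)
qed

text \<open>Two overlapping subcontinua of which neither contains the other decompose their union;
  conversely the two pieces of a decomposition overlap, as a connected set is no disjoint union of
  two nonempty closed sets. This form passes to subspaces and can be compared through lifts.\<close>

lemma hereditarily_indecomposable_iff_nested: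
  "hereditarily_indecomposable X \<longleftrightarrow> continuum_space X \<and>
     (\<forall>A B. subcontinuum X A \<and> subcontinuum X B \<and> A \<inter> B \<noteq> {} \<longrightarrow> A \<subseteq> B \<or> B \<subseteq> A)"
proof (cases "continuum_space X")
  case True
  then have met: "metrizable_space X" and haus: "Hausdorff_space X"
    by (auto simp: continuum_space_def metrizable_imp_Hausdorff_space)
  have sub: "subcontinuum (subtopology X K) A \<longleftrightarrow> subcontinuum X A \<and> A \<subseteq> K" for K A
    using met by (auto simp: subcontinuum_iff metrizable_space_subtopology
        compactin_subtopology connectedin_subtopology)
  show ?thesis
  proof
    assume hi: "hereditarily_indecomposable X"
    have False if A: "subcontinuum X A" and B: "subcontinuum X B" and AB: "A \<inter> B \<noteq> {}"
      and n: "\<not> A \<subseteq> B" "\<not> B \<subseteq> A" for A B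
    proof -
      have K: "subcontinuum X (A \<union> B)"
        using A B AB met by (auto simp: subcontinuum_iff intro: compactin_Un connectedin_Un)
      have top: "topspace (subtopology X (A \<union> B)) = A \<union> B"
        using K by (auto simp: subcontinuum_def)
      \<comment> \<open>Neither set is a single point: it meets the other one without lying inside
        it.\<close>
      have "proper_subcontinuum (subtopology X (A \<union> B)) A"
        unfolding proper_subcontinuum_def sub top using A AB n by auto
      moreover have "proper_subcontinuum (subtopology X (A \<union> B)) B"
        unfolding proper_subcontinuum_def sub top using B AB n by auto
      ultimately have "\<not> indecomposable_space (subtopology X (A \<union> B))"
        unfolding indecomposable_space_def top by blast
      then show False using hi K by (auto simp: hereditarily_indecomposable_def)
    qed
    then show "continuum_space X \<and>
     (\<forall>A B. subcontinuum X A \<and> subcontinuum X B \<and> A \<inter> B \<noteq> {} \<longrightarrow> A \<subseteq> B \<or> B \<subseteq> A)"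
      using True by blast
  next
    assume nest: "continuum_space X \<and>
     (\<forall>A B. subcontinuum X A \<and> subcontinuum X B \<and> A \<inter> B \<noteq> {} \<longrightarrow> A \<subseteq> B \<or> B \<subseteq> A)"
    have "indecomposable_space (subtopology X K)" if K: "subcontinuum X K" for K
      unfolding indecomposable_space_def
    proof (intro notI, elim exE conjE)
      fix A B
      assume A: "proper_subcontinuum (subtopology X K) A"
        and B: "proper_subcontinuum (subtopology X K) B"
        and AB: "A \<union> B = topspace (subtopology X K)"
      have top: "topspace (subtopology X K) = K"
        using K by (auto simp: subcontinuum_def)
      have A': "subcontinuum X A" "A \<subseteq> K" "A \<noteq> K" and B': "subcontinuum X B" "B \<subseteq> K" "B \<noteq> K"
        using A B unfolding proper_subcontinuum_def sub top by auto
      have "A \<inter> B \<noteq> {}"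
      proof
        assume dis: "A \<inter> B = {}"
        have "closedin X A" "closedin X B" "A \<noteq> {}" "B \<noteq> {}"
          using A' B' met haus by (auto simp: subcontinuum_iff compactin_imp_closedin)
        moreover have "connectedin X K" using K met by (simp add: subcontinuum_iff)
        ultimately show False
          using dis AB A'(2) B'(2) unfolding top connectedin_closedin by blast
      qed
      then have "A \<subseteq> B \<or> B \<subseteq> A" using nest A' B' by blast
      then show False using AB A' B' unfolding top by blast
    qed
    then show "hereditarily_indecomposable X"
      using True by (simp add: hereditarily_indecomposable_def)
  qed
qed (simp add: hereditarily_indecomposable_def)

lemma homeomorphic_hereditarily_indecomposable:
  assumes "X homeomorphic_space Y" "hereditarily_indecomposable X"
  shows "hereditarily_indecomposable Y"
proof -
  obtain f where f: "homeomorphic_map Y X f"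
    using assms(1) homeomorphic_space homeomorphic_space_sym by blast
  have inj: "inj_on f (topspace Y)" using f by (simp add: homeomorphic_imp_injective_map)
  show ?thesis
    unfolding hereditarily_indecomposable_iff_nested
  proof (intro conjI allI impI)
    show "continuum_space Y"
      using assms homeomorphic_continuum_space hereditarily_indecomposable_def by blast
  next
    fix A B assume *: "subcontinuum Y A \<and> subcontinuum Y B \<and> A \<inter> B \<noteq> {}"
    then have "A \<subseteq> topspace Y" "B \<subseteq> topspace Y" by (auto simp: subcontinuum_def)
    moreover have "f ` A \<subseteq> f ` B \<or> f ` B \<subseteq> f ` A"
      using assms(2) * subcontinuum_homeomorphic_image[OF f]
      unfolding hereditarily_indecomposable_iff_nested by blast
    ultimately show "A \<subseteq> B \<or> B \<subseteq> A"
      using inj by (meson inj_on_image_subset_iff)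
  qed
qed

lemma hereditarily_indecomposable_subcontinuum:
  assumes "hereditarily_indecomposable X" "subcontinuum X K"
  shows "hereditarily_indecomposable (subtopology X K)"
proof -
  have met: "metrizable_space X" 
    using assms(1) by (auto simp: hereditarily_indecomposable_def continuum_space_def)
  have "subcontinuum (subtopology X K) A \<longleftrightarrow> subcontinuum X A \<and> A \<subseteq> K" for A
    using met by (auto simp: subcontinuum_iff metrizable_space_subtopology
        compactin_subtopology connectedin_subtopology)
  then show ?thesis
    using assms unfolding hereditarily_indecomposable_iff_nested
    by (auto simp: subcontinuum_def)
qed

text \<open>Covers travel backwards along \<open>f\<close> and refining lists forwards; both
  transfer lemmas for chainability start with this.\<close>

lemma refining_list_transfer:
  assumes f: "homeomorphic_map X Y f"
    and U: "\<forall>U\<in>\<U>. openin Y U" "topspace Y \<subseteq> \<Union>\<U>"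
  obtains \<V> where "\<forall>V\<in>\<V>. openin X V" "topspace X \<subseteq> \<Union>\<V>"
    "\<And>L. refines L \<V> \<Longrightarrow> refines (map ((`) f) L) \<U>"
proof
  let ?V = "(\<lambda>U. {x \<in> topspace X. f x \<in> U}) ` \<U>"
  have cont: "continuous_map X Y f" using f by (simp add: homeomorphic_imp_continuous_map)
  show "\<forall>V\<in>?V. openin X V"
    using U(1) cont by (auto simp: openin_continuous_map_preimage)
  show "topspace X \<subseteq> \<Union>?V"
    using U(2) continuous_map_image_subset_topspace[OF cont] by fastforce
  show "refines (map ((`) f) L) \<U>" if "refines L ?V" for L
    unfolding refines_def
  proof
    fix W assume "W \<in> set (map ((`) f) L)"
    then obtain V where V: "V \<in> set L" "W = f ` V" by auto
    then obtain U where "U \<in> \<U>" "V \<subseteq> {x \<in> topspace X. f x \<in> U}"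
      using \<open>refines L ?V\<close> unfolding refines_def by blast
    then show "\<exists>U\<in>\<U>. W \<subseteq> U" using V by blast
  qed
qed

lemma chain_links_homeomorphic_image:
  assumes f: "homeomorphic_map X Y f" and L: "\<forall>U\<in>set L. openin X U" "topspace X \<subseteq> \<Union>(set L)"
  shows "\<forall>U\<in>set (map ((`) f) L). openin Y U" "topspace Y \<subseteq> \<Union>(set (map ((`) f) L))"
    "\<And>i j. i < length L \<Longrightarrow> j < length L \<Longrightarrow>
       map ((`) f) L ! i \<inter> map ((`) f) L ! j \<noteq> {} \<longleftrightarrow> L ! i \<inter> L ! j \<noteq> {}"
proof -
  show "\<forall>U\<in>set (map ((`) f) L). openin Y U"
    using homeomorphic_imp_open_map[OF f] L(1) by (auto simp: open_map_def)
  show "topspace Y \<subseteq> \<Union>(set (map ((`) f) L))"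
    unfolding homeomorphic_imp_surjective_map[OF f, symmetric] set_map
    using L(2) by blast
  fix i j assume ij: "i < length L" "j < length L"
  then have "L ! i \<subseteq> topspace X" "L ! j \<subseteq> topspace X"
    using L(1) by (meson nth_mem openin_subset)+
  then have "f ` (L ! i \<inter> L ! j) = f ` (L ! i) \<inter> f ` (L ! j)"
    using homeomorphic_imp_injective_map[OF f] by (simp add: inj_on_image_Int)
  then show "map ((`) f) L ! i \<inter> map ((`) f) L ! j \<noteq> {} \<longleftrightarrow> L ! i \<inter> L ! j \<noteq> {}"
    using ij by (metis image_is_empty nth_map)
qed

lemma homeomorphic_chainable:
  assumes "X homeomorphic_space Y" "chainable X"
  shows "chainable Y"
  unfolding chainable_def
proof (intro allI impI, elim conjE)
  fix \<U> assume U: "\<forall>U\<in>\<U>. openin Y U" "topspace Y \<subseteq> \<Union>\<U>"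
  obtain f where f: "homeomorphic_map X Y f" using assms(1) homeomorphic_space by blast
  obtain \<V> where V: "\<forall>V\<in>\<V>. openin X V" "topspace X \<subseteq> \<Union>\<V>"
    "\<And>L. refines L \<V> \<Longrightarrow> refines (map ((`) f) L) \<U>"
    using refining_list_transfer[OF f U] by blast
  then obtain L where L: "is_chain X L" "refines L \<V>"
    using assms(2) unfolding chainable_def by blast
  note im = chain_links_homeomorphic_image[OF f, of L]
  have "is_chain Y (map ((`) f) L)"
    using L(1) im unfolding is_chain_def length_map by (metis (no_types) map_is_Nil_conv)
  then show "\<exists>L. is_chain Y L \<and> refines L \<U>" using V(3) L(2) by blast
qed

lemma homeomorphic_circularly_chainable:
  assumes "X homeomorphic_space Y" "circularly_chainable X"
  shows "circularly_chainable Y"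
  unfolding circularly_chainable_def
proof (intro allI impI, elim conjE)
  fix \<U> assume U: "\<forall>U\<in>\<U>. openin Y U" "topspace Y \<subseteq> \<Union>\<U>"
  obtain f where f: "homeomorphic_map X Y f" using assms(1) homeomorphic_space by blast
  obtain \<V> where V: "\<forall>V\<in>\<V>. openin X V" "topspace X \<subseteq> \<Union>\<V>"
    "\<And>L. refines L \<V> \<Longrightarrow> refines (map ((`) f) L) \<U>"
    using refining_list_transfer[OF f U] by blast
  then obtain L where L: "is_circular_chain X L" "refines L \<V>"
    using assms(2) unfolding circularly_chainable_def by blast
  note im = chain_links_homeomorphic_image[OF f, of L]
  have "is_circular_chain Y (map ((`) f) L)"
    using L(1) im unfolding is_circular_chain_def length_map by (metis (no_types))
  then show "\<exists>L. is_circular_chain Y L \<and> refines L \<U>" using V(3) L(2) by blast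
qed

lemma homeomorphic_pseudo_arc:
  assumes "X homeomorphic_space Y" "pseudo_arc X"
  shows "pseudo_arc Y"
proof -
  obtain f where f: "homeomorphic_map X Y f" using assms(1) homeomorphic_space by blast
  obtain x y where "x \<in> topspace X" "y \<in> topspace X" "x \<noteq> y"
    using assms(2) by (auto simp: pseudo_arc_def)
  then have "f x \<in> topspace Y" "f y \<in> topspace Y" "f x \<noteq> f y"
    using homeomorphic_imp_surjective_map[OF f] homeomorphic_imp_injective_map[OF f]
    by (auto simp: inj_on_def)
  then show ?thesis
    using assms homeomorphic_chainable homeomorphic_hereditarily_indecomposable
      homeomorphic_continuum_space
    unfolding pseudo_arc_def by blast
qed

section \<open>Proper subcontinua of circularly chainable continua\<close>

text \<open>Adjacency modulo the length is invariant under the cyclic successor \<open>a\<close>.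
  Rotation lets any chosen link become link 0, where a circular chain can be cut.\<close>

lemma is_circular_chain_rotate1:
  assumes "is_circular_chain X L"
  shows "is_circular_chain X (rotate1 L)"
proof -
  define n where "n = length L"
  have n: "n \<ge> 3" using assms by (simp add: is_circular_chain_def n_def)
  define a where "a i = (if Suc i = n then 0 else Suc i)" for i
  have a: "rotate1 L ! i = L ! a i" "a i < n" if "i < n" for i
    using that n by (auto simp: nth_rotate1 n_def a_def mod_Suc)
  have adj: "((a i \<le> a j + 1 \<and> a j \<le> a i + 1) \<or> (a i = 0 \<and> a j = n - 1) \<or> (a j = 0 \<and> a i = n - 1))
      \<longleftrightarrow> ((i \<le> j + 1 \<and> j \<le> i + 1) \<or> (i = 0 \<and> j = n - 1) \<or> (j = 0 \<and> i = n - 1))"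
    if "i < n" "j < n" for i j
    using that n unfolding a_def by (simp split: if_splits) linarith
  show ?thesis
    unfolding is_circular_chain_def
  proof (intro conjI allI impI)
    fix i j assume "i < length (rotate1 L)" "j < length (rotate1 L)"
    then have ij: "i < n" "j < n" by (auto simp: n_def)
    have "(L ! a i \<inter> L ! a j \<noteq> {}) \<longleftrightarrow> ((a i \<le> a j + 1 \<and> a j \<le> a i + 1) \<or>
        (a i = 0 \<and> a j = n - 1) \<or> (a j = 0 \<and> a i = n - 1))"
      using assms a[OF ij(1)] a[OF ij(2)] unfolding is_circular_chain_def n_def by blast
    then show "(rotate1 L ! i \<inter> rotate1 L ! j \<noteq> {}) = (i \<le> j + 1 \<and> j \<le> i + 1 \<or>
        i = 0 \<and> j = length (rotate1 L) - 1 \<or> j = 0 \<and> i = length (rotate1 L) - 1)"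
      using a[OF ij(1)] a[OF ij(2)] adj[OF ij] by (simp add: n_def)
  qed (use assms in \<open>auto simp: is_circular_chain_def\<close>)
qed

lemma is_circular_chain_rotate:
  "is_circular_chain X L \<Longrightarrow> is_circular_chain X (rotate k L)"
  by (induction k) (auto simp: is_circular_chain_rotate1)

text \<open>A link avoiding \<open>Q\<close> cuts the circular chain open; the links meeting the connected
  set \<open>Q\<close> are then consecutive.\<close>

lemma chainable_proper_subcontinuum:
  assumes chain: "circularly_chainable X" and Q: "subcontinuum X Q" and ne: "Q \<noteq> topspace X"
    and met: "metrizable_space X"
  shows "chainable (subtopology X Q)"
  unfolding chainable_def
proof (intro allI impI, elim conjE)
  fix \<U> assume U: "\<forall>U\<in>\<U>. openin (subtopology X Q) U" "topspace (subtopology X Q) \<subseteq> \<Union>\<U>"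
  have Qsub: "Q \<subseteq> topspace X" and Qne: "Q \<noteq> {}" and comp: "compactin X Q" and conn: "connectedin X Q"
    using Q met compactin_subset_topspace by (auto simp: subcontinuum_iff)
  have top: "topspace (subtopology X Q) = Q" using Qsub by auto
  obtain x where x: "x \<in> topspace X" "x \<notin> Q" using ne Qsub by blast
  have haus: "Hausdorff_space X" using met by (rule metrizable_imp_Hausdorff_space)
  have opx: "openin X (topspace X - {x})"
    using haus x closedin_t1_singleton Hausdorff_imp_t1_space by (metis openin_diff openin_topspace)
  have opQ: "openin X (topspace X - Q)"
    using haus comp compactin_imp_closedin by blast
  \<comment> \<open>Only \<open>topspace X - Q\<close> contains \<open>x\<close>, so a link around
    \<open>x\<close> must miss \<open>Q\<close>.\<close>
  define \<V> where "\<V> = insert (topspace X - Q) {V. openin X V \<and> x \<notin> V \<and> V \<inter> Q \<in> \<U>}"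
  have "topspace X \<subseteq> \<Union>\<V>"
  proof
    fix y assume y: "y \<in> topspace X"
    show "y \<in> \<Union>\<V>"
    proof (cases "y \<in> Q")
      case True
      then obtain W where W: "W \<in> \<U>" "y \<in> W" using U(2) top by auto
      then obtain V where V: "openin X V" "W = V \<inter> Q"
        using U(1) by (auto simp: openin_subtopology)
      have "(V \<inter> (topspace X - {x})) \<inter> Q = W" using V Qsub x by blast
      then have "V \<inter> (topspace X - {x}) \<in> \<V>" using V(1) W(1) opx by (auto simp: \<V>_def)
      then show ?thesis using W V Qsub x True by blast
    qed (use y in \<open>auto simp: \<V>_def\<close>)
  qed
  moreover have "\<forall>V\<in>\<V>. openin X V" using opQ by (auto simp: \<V>_def)
  ultimately obtain L0 where L0: "is_circular_chain X L0" "refines L0 \<V>"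
    using chain unfolding circularly_chainable_def by blast
  have "topspace X \<subseteq> \<Union>(set L0)" using L0(1) by (simp add: is_circular_chain_def)
  then obtain k where k: "k < length L0" "x \<in> L0 ! k"
    using x(1) by (metis UnionE in_set_conv_nth subsetD)
  define L where "L = rotate k L0"
  define n where "n = length L"
  have circ: "is_circular_chain X L" using L0(1) by (simp add: L_def is_circular_chain_rotate)
  have n: "n \<ge> 3" using circ by (simp add: n_def is_circular_chain_def)
  have ref: "\<exists>V\<in>\<V>. L ! i \<subseteq> V" if "i < n" for i
  proof -
    have "L ! i \<in> set L0" using nth_mem[of i L] that by (simp add: L_def n_def)
    then show ?thesis using L0(2) by (simp add: refines_def)
  qed
  have "L0 \<noteq> []" using k by auto
  then have "x \<in> L ! 0" using k nth_rotate[of 0 L0 k] by (simp add: L_def)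
  then have L0Q: "L ! 0 \<inter> Q = {}"
    using ref[of 0] n by (auto simp: \<V>_def)
  have opL: "openin X (L ! i)" if "i < n" for i
    using circ that by (auto simp: is_circular_chain_def n_def)
  \<comment> \<open>Both indices are positive, so the wrap-around clause of a circular chain cannot
    apply and only neighbours meet.\<close>
  have far: "L ! i \<inter> L ! j = {}" if "0 < i" "i + 1 < j" "j < n" for i j
  proof -
    have "(L ! i \<inter> L ! j \<noteq> {}) \<longleftrightarrow> (i \<le> j + 1 \<and> j \<le> i + 1) \<or>
        (i = 0 \<and> j = length L - 1) \<or> (j = 0 \<and> i = length L - 1)"
      using circ that unfolding is_circular_chain_def n_def by simp
    then show ?thesis using that by auto
  qed
  have covQ: "\<exists>i. 0 < i \<and> i < n \<and> y \<in> L ! i" if y: "y \<in> Q" for y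
  proof -
    have "topspace X \<subseteq> \<Union>(set L)" using circ by (simp add: is_circular_chain_def)
    then obtain i where "i < n" "y \<in> L ! i"
      using y Qsub by (metis UnionE in_set_conv_nth n_def subsetD)
    then show ?thesis using L0Q y by (cases i) auto
  qed
  \<comment> \<open>If no link after \<open>L ! i\<close> met \<open>L ! i\<close> inside \<open>Q\<close>, then \<open>Q\<close> would be
    separated by the union of the first links and the union of the later ones.\<close>
  have link: "L ! i \<inter> L ! Suc i \<inter> Q \<noteq> {}"
    if "0 < l" "l \<le> i" "Suc i \<le> m" "m < n" "L ! l \<inter> Q \<noteq> {}" "L ! m \<inter> Q \<noteq> {}" for i l m
  proof
    assume dis: "L ! i \<inter> L ! Suc i \<inter> Q = {}"
    define A where "A = \<Union>((!) L ` {0<..i})"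
    define B where "B = \<Union>((!) L ` {i<..<n})"
    have "openin X A" "openin X B"
      using opL that unfolding A_def B_def by (auto intro!: openin_Union)
    moreover have "Q \<subseteq> A \<union> B"
    proof
      fix y assume "y \<in> Q"
      then obtain k where "0 < k" "k < n" "y \<in> L ! k" using covQ by blast
      then show "y \<in> A \<union> B" unfolding A_def B_def by (cases "k \<le> i") auto
    qed
    moreover have "A \<inter> B \<inter> Q = {}"
    proof (rule ccontr)
      assume "A \<inter> B \<inter> Q \<noteq> {}"
      then obtain y a b where y: "y \<in> Q" "y \<in> L ! a" "y \<in> L ! b" "0 < a" "a \<le> i" "i < b" "b < n"
        unfolding A_def B_def by auto
      then have "\<not> a + 1 < b" using far[of a b] by blast
      then have "a = i" "b = Suc i" using y by auto
      then show False using dis y by blast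
    qed
    moreover have "L ! l \<subseteq> A" "L ! m \<subseteq> B"
      using that unfolding A_def B_def by (auto simp: Suc_le_eq)
    then have "A \<inter> Q \<noteq> {}" "B \<inter> Q \<noteq> {}" using that by blast+
    ultimately show False
      using conn unfolding connectedin by blast
  qed
  define I where "I = {i. 0 < i \<and> i < n \<and> L ! i \<inter> Q \<noteq> {}}"
  have fin: "finite I" by (rule finite_subset[of _ "{..<n}"]) (auto simp: I_def)
  have Ine: "I \<noteq> {}" using covQ Qne by (auto simp: I_def)
  \<comment> \<open>First and last link meeting \<open>Q\<close>; by \<open>link\<close> every link
    between them meets its successor inside \<open>Q\<close>, so the traces on \<open>Q\<close> form
    a linear chain.\<close>
  define l m where "l = Min I" and "m = Max I"
  have lI: "l \<in> I" and mI: "m \<in> I" and lm: "\<And>i. i \<in> I \<Longrightarrow> l \<le> i \<and> i \<le> m"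
    using fin Ine by (auto simp: l_def m_def)
  have l0: "0 < l" "l \<le> m" "m < n" "L ! l \<inter> Q \<noteq> {}" "L ! m \<inter> Q \<noteq> {}"
    using lI mI lm by (auto simp: I_def)
  define N where "N = map (\<lambda>i. L ! i \<inter> Q) [l..<Suc m]"
  have lenN: "length N = Suc m - l" by (simp add: N_def del: upt_Suc)
  have nthN: "N ! i = L ! (l + i) \<inter> Q" if "i < length N" for i
    using that by (simp add: N_def lenN del: upt_Suc)
  have linkN: "N ! i \<inter> N ! Suc i \<noteq> {}" if "Suc i < length N" for i
  proof -
    have "L ! (l + i) \<inter> L ! Suc (l + i) \<inter> Q \<noteq> {}"
      using link[OF l0(1), of "l + i" m] l0 that by (simp add: lenN)
    then show ?thesis using nthN[of i] nthN[of "Suc i"] that by auto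
  qed
  have neN: "N ! i \<noteq> {}" if "i < length N" for i
  proof (cases "Suc i < length N")
    case True then show ?thesis using linkN by blast
  next
    case False
    then have "l + i = m" using that by (auto simp: lenN)
    then show ?thesis using nthN[OF that] l0 by simp
  qed
  have farN: "N ! i \<inter> N ! j = {}" if "i + 1 < j" "j < length N" for i j
  proof -
    have "L ! (l + i) \<inter> L ! (l + j) = {}"
      using far[of "l + i" "l + j"] l0 that by (auto simp: lenN)
    then show ?thesis using nthN[of i] nthN[of j] that by auto
  qed
  have "is_chain (subtopology X Q) N"
    unfolding is_chain_def
  proof (intro conjI allI impI)
    show "N \<noteq> []" using l0 by (simp add: N_def)
    show "\<forall>U\<in>set N. openin (subtopology X Q) U"
    proof
      fix W assume "W \<in> set N"
      then obtain i where "i \<le> m" "W = L ! i \<inter> Q" unfolding N_def by (auto simp: less_Suc_eq_le simp del: upt_Suc)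
      then show "openin (subtopology X Q) W"
        using opL[of i] l0 by (auto simp: openin_subtopology)
    qed
    show "topspace (subtopology X Q) \<subseteq> \<Union>(set N)"
    proof
      fix y assume "y \<in> topspace (subtopology X Q)"
      then have y: "y \<in> Q" by simp
      then obtain i where "0 < i" "i < n" "y \<in> L ! i" using covQ by blast
      then have "i \<in> I" using y by (auto simp: I_def)
      then have "i \<in> set [l..<Suc m]" using lm by (simp add: less_Suc_eq_le del: upt_Suc)
      then show "y \<in> \<Union>(set N)" using \<open>y \<in> L ! i\<close> y by (auto simp: N_def simp del: upt_Suc)
    qed
    fix i j assume ij: "i < length N" "j < length N"
    consider "i = j" | "j = Suc i" | "i = Suc j" | "i + 1 < j" | "j + 1 < i" by linarith
    then show "(N ! i \<inter> N ! j \<noteq> {}) = (i \<le> j + 1 \<and> j \<le> i + 1)"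
    proof cases
      case 1 then show ?thesis using neN ij by simp
    next
      case 2 then show ?thesis using linkN[of i] ij by auto
    next
      case 3 then show ?thesis using linkN[of j] ij by auto
    next
      case 4 then show ?thesis using farN[of i j] ij by auto
    next
      case 5 then show ?thesis using farN[of j i] ij by auto
    qed
  qed
  moreover have "refines N \<U>"
    unfolding refines_def
  proof
    fix W assume "W \<in> set N"
    then obtain i where i: "i < length N" "W = N ! i" by (metis in_set_conv_nth)
    then have W: "W = L ! (l + i) \<inter> Q" "W \<noteq> {}" "l + i < n"
      using nthN neN l0 by (auto simp: lenN)
    then obtain V where "V \<in> \<V>" "L ! (l + i) \<subseteq> V" using ref by blast
    \<comment> \<open>The nonempty trace \<open>W\<close> excludes the one member of the cover that
      does not come from \<open>\<U>\<close>.\<close>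
    moreover have "V \<noteq> topspace X - Q" using calculation W by blast
    ultimately have "V \<inter> Q \<in> \<U>" "W \<subseteq> V \<inter> Q" using W by (auto simp: \<V>_def)
    then show "\<exists>U\<in>\<U>. W \<subseteq> U" by blast
  qed
  ultimately show "\<exists>L. is_chain (subtopology X Q) L \<and> refines L \<U>" by blast
qed

section \<open>The ternary Cantor set\<close>

lemma cantor_ternary_sub: "cantor_ternary \<subseteq> {0..1}"
proof
  fix x assume "x \<in> cantor_ternary"
  then obtain d :: "nat \<Rightarrow> nat" where d: "\<And>n. d n = 0 \<or> d n = 2"
    and s: "(\<lambda>n. real (d n) / 3 ^ Suc n) sums x"
    by (auto simp: cantor_ternary_def)
  have "(\<lambda>n. (1/3) ^ n) sums (1 / (1 - 1/3 :: real))" by (rule geometric_sums) simp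
  from sums_mult[OF this, of "2/3"] have g: "(\<lambda>n. 2 / 3 ^ Suc n) sums (1::real)"
    by (simp add: power_one_over field_simps)
  have le: "real (d n) / 3 ^ Suc n \<le> 2 / 3 ^ Suc n" for n
    using d[of n] by (intro divide_right_mono) auto
  have "x \<le> 1" by (rule sums_le[OF le s g])
  moreover have "0 \<le> x" by (rule sums_le[OF _ sums_zero s]) simp
  ultimately show "x \<in> {0..1}" by simp
qed

text \<open>Self-similarity: the ternary set lies in the union of its two copies of ratio 1/3.
  Closedness and total disconnectedness are both drawn from it.\<close>

lemma cantor_ternary_first_digit:
  assumes "x \<in> cantor_ternary"
  shows "\<exists>e\<in>{0, 2}. 3 * x - e \<in> cantor_ternary"
proof -
  obtain d :: "nat \<Rightarrow> nat" where d: "\<And>n. d n = 0 \<or> d n = 2"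
    and s: "(\<lambda>n. real (d n) / 3 ^ Suc n) sums x"
    using assms by (auto simp: cantor_ternary_def)
  have "(\<lambda>n. real (d (Suc n)) / 3 ^ Suc (Suc n)) sums (x - real (d 0) / 3)"
    using s by (subst sums_Suc_iff) simp
  from sums_mult[OF this, of 3] have "(\<lambda>n. real (d (Suc n)) / 3 ^ Suc n) sums (3 * x - real (d 0))"
    by (simp add: right_diff_distrib)
  then have "3 * x - real (d 0) \<in> cantor_ternary"
    using d unfolding cantor_ternary_def by (auto intro!: exI[of _ "\<lambda>n. d (Suc n)"])
  moreover have "real (d 0) \<in> {0, 2}" using d[of 0] by auto
  ultimately show ?thesis by blast
qed

text \<open>The self-similarity passes to the closure, so a limit point can be expanded digit by
  digit: the remainders stay in the closure, hence in [0, 1], and the digits read off sum to the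
  point.\<close>

lemma compact_cantor_ternary: "compact cantor_ternary"
proof -
  let ?C = "closure cantor_ternary"
  have C01: "?C \<subseteq> {0..1}" using cantor_ternary_sub by (simp add: closure_minimal)
  have step: "\<exists>e\<in>{0, 2::nat}. 3 * y - real e \<in> ?C" if y: "y \<in> ?C" for y
  proof -
    define P where "P e = (\<lambda>x. 3 * x - e) -` ?C" for e :: real
    have "closed (P e)" for e
      unfolding P_def by (intro closed_vimage continuous_intros) simp
    then have "closed (P 0 \<union> P 2)" by blast
    moreover have "cantor_ternary \<subseteq> P 0 \<union> P 2"
      using cantor_ternary_first_digit closure_subset unfolding P_def by fastforce
    ultimately have "?C \<subseteq> P 0 \<union> P 2" by (rule closure_minimal[rotated])
    then show ?thesis using y by (auto simp: P_def)
  qed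
  then obtain e :: "real \<Rightarrow> nat" where e: "\<And>y. y \<in> ?C \<Longrightarrow> (e y = 0 \<or> e y = 2) \<and> 3 * y - real (e y) \<in> ?C"
    by (metis insert_iff empty_iff)
  have "?C \<subseteq> cantor_ternary"
  proof
    fix y assume y: "y \<in> ?C"
    \<comment> \<open>Remainder after \<open>n\<close> digits, rescaled by \<open>3 ^ n\<close>; the
      next digit is \<open>e (r n)\<close>.\<close>
    define r where "r n = ((\<lambda>y. 3 * y - real (e y)) ^^ n) y" for n
    have rC: "r n \<in> ?C" for n
      by (induction n) (use y e in \<open>auto simp: r_def\<close>)
    have r01: "0 \<le> r n" "r n \<le> 1" for n using rC[of n] C01 by auto
    have part: "(\<Sum>i<n. real (e (r i)) / 3 ^ Suc i) = y - r n / 3 ^ n" for n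
      by (induction n) (auto simp: r_def field_simps)
    have "(\<lambda>n. r n / 3 ^ n) \<longlonglongrightarrow> 0"
    proof (rule tendsto_sandwich[OF _ _ tendsto_const])
      show "\<forall>\<^sub>F n in sequentially. 0 \<le> r n / 3 ^ n" by (simp add: r01)
      show "\<forall>\<^sub>F n in sequentially. r n / 3 ^ n \<le> (1/3) ^ n"
        by (simp add: r01 power_one_over divide_right_mono)
      show "(\<lambda>n. (1/3::real) ^ n) \<longlonglongrightarrow> 0" by (rule LIMSEQ_realpow_zero) auto
    qed
    then have "(\<lambda>n. y - r n / 3 ^ n) \<longlonglongrightarrow> y - 0" by (intro tendsto_diff tendsto_const)
    then have "(\<lambda>i. real (e (r i)) / 3 ^ Suc i) sums y"
      unfolding sums_def part by simp
    then show "y \<in> cantor_ternary"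
      using e rC unfolding cantor_ternary_def by (auto intro!: exI[of _ "\<lambda>i. e (r i)"])
  qed
  then have "closed cantor_ternary" using closure_subset closure_closed
    by (metis closed_closure subset_antisym)
  then show ?thesis
    using cantor_ternary_sub by (meson bounded_closed_interval bounded_subset compact_eq_bounded_closed)
qed

text \<open>An interval inside the set cannot contain 1/2, so it lies in one outer third, and its
  threefold blow-up is again an interval inside the set.\<close>

lemma cantor_ternary_interval_length:
  "a \<le> b \<Longrightarrow> {a..b} \<subseteq> cantor_ternary \<Longrightarrow> b - a \<le> (1/3) ^ n"
proof (induction n arbitrary: a b)
  case 0
  then have "a \<in> {0..1}" "b \<in> {0..1}" using cantor_ternary_sub by force+
  then show ?case by simp
next
  case (Suc n)
  have dich: "x \<le> 1/3 \<and> 3 * x \<in> cantor_ternary \<or> x \<ge> 2/3 \<and> 3 * x - 2 \<in> cantor_ternary"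
    if "x \<in> {a..b}" for x
    using cantor_ternary_first_digit[of x] Suc.prems that cantor_ternary_sub by force
  have "(\<exists>e. \<forall>x\<in>{a..b}. 3 * x - e \<in> cantor_ternary)"
  proof (cases "a \<le> 1/3")
    case True
    have "\<not> 1/2 \<in> {a..b}" using dich[of "1/2"] by auto
    then have "b < 1/2" using True by auto
    then have "\<forall>x\<in>{a..b}. 3 * x - 0 \<in> cantor_ternary" using dich by fastforce
    then show ?thesis by blast
  next
    case False
    then have "\<forall>x\<in>{a..b}. 3 * x - 2 \<in> cantor_ternary" using dich by fastforce
    then show ?thesis by blast
  qed
  then obtain e where e: "\<And>x. x \<in> {a..b} \<Longrightarrow> 3 * x - e \<in> cantor_ternary" by blast
  have "{3 * a - e..3 * b - e} \<subseteq> cantor_ternary"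
  proof
    fix y assume "y \<in> {3 * a - e..3 * b - e}"
    then have "(y + e) / 3 \<in> {a..b}" by auto
    from e[OF this] show "y \<in> cantor_ternary" by (simp add: add_divide_distrib)
  qed
  then have "(3 * b - e) - (3 * a - e) \<le> (1/3) ^ n"
    using Suc.prems(1) by (intro Suc.IH) auto
  then show ?case by simp
qed

lemma totally_disconnected_cantor_ternary:
  assumes "connected D" "D \<subseteq> cantor_ternary" "a \<in> D" "b \<in> D"
  shows "a = b"
proof -
  have *: "b \<le> a" if "a \<in> D" "b \<in> D" "a \<le> b" for a b
  proof (rule field_le_epsilon)
    fix \<epsilon> :: real assume "\<epsilon> > 0"
    then obtain n where n: "(1/3) ^ n < \<epsilon>" using real_arch_pow_inv[of \<epsilon> "1/3"] by auto
    have "{a..b} \<subseteq> cantor_ternary"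
      using assms that connected_contains_Icc by blast
    then show "b \<le> a + \<epsilon>" using cantor_ternary_interval_length[of a b n] that n by linarith
  qed
  show ?thesis using *[of a b] *[of b a] assms by linarith
qed

section \<open>Essential cofrontiers and their lifts under exp\<close>

text \<open>A path in \<open>D\<close> from \<open>exp w\<close> to \<open>d\<close> lifts to a path
  from \<open>w\<close> that ends over \<open>d\<close>, hence in \<open>H\<close>. In the uses
  \<open>H\<close> is a half plane containing all logarithms of \<open>d\<close> at once.\<close>

lemma connected_exp_vimage:
  assumes D: "path_connected D" "D \<subseteq> -{0}" and H: "connected H" "H \<subseteq> exp -` D"
    and d: "d \<in> D" "exp -` {d} \<subseteq> H"
  shows "connected (exp -` D :: complex set)"
proof -
  have reach: "\<exists>w'\<in>H. connected_component (exp -` D) w w'" if w: "w \<in> exp -` D" for w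
  proof -
    obtain g where g: "path g" "path_image g \<subseteq> D" "pathstart g = exp w" "pathfinish g = d"
      using D(1) d(1) w unfolding path_connected_def by (metis vimageE)
    obtain k where k: "path k" "pathstart k = w" "\<And>t. t \<in> {0..1} \<Longrightarrow> exp (k t) = g t"
      using covering_space_lift_path_strong[OF covering_space_exp_punctured_plane, of w g]
        g D(2) by blast
    have "path_image k \<subseteq> exp -` D" using k(3) g(2) by (auto simp: path_image_def)
    moreover have "pathfinish k \<in> H"
      using k(3)[of 1] g(4) d(2) by (auto simp: pathfinish_def)
    moreover have "connected (path_image k)" using k(1) by (rule connected_path_image)
    ultimately show ?thesis
      using k(2) unfolding connected_component_def by (metis pathfinish_in_path_image pathstart_in_path_image)
  qed
  show ?thesis
    unfolding connected_iff_connected_component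
  proof (intro ballI)
    fix x y assume "x \<in> exp -` D" "y \<in> exp -` D"
    then obtain x' y' where "x' \<in> H" "y' \<in> H" "connected_component (exp -` D) x x'"
      "connected_component (exp -` D) y y'" using reach by metis
    moreover have "connected_component (exp -` D) x' y'"
      using H calculation(1,2) unfolding connected_component_def by blast
    ultimately show "connected_component (exp -` D) x y"
      by (meson connected_component_sym connected_component_trans)
  qed
qed

text \<open>Holds because \<open>exp\<close> is an open map: a neighbourhood of \<open>w\<close>
  missing the preimage would have an open image around \<open>exp w\<close> missing
  \<open>D\<close>.\<close>

lemma closure_exp_vimage:
  assumes "exp w \<in> closure D" 
  shows "(w::complex) \<in> closure (exp -` D)"
proof (rule ccontr)
  assume "w \<notin> closure (exp -` D)"
  define N where "N = - closure (exp -` D)"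
  have N: "open N" "w \<in> N" "N \<inter> exp -` D = {}"
    using \<open>w \<notin> closure (exp -` D)\<close> closure_subset[of "exp -` D"] by (auto simp: N_def open_Compl)
  have "openin (top_of_set (-{0})) (exp ` N)"
    using covering_space_open_map[OF covering_space_exp_punctured_plane] N(1) by simp
  then have "open (exp ` N)" by (metis openin_open_eq open_Compl closed_singleton)
  then have "exp ` N \<inter> D \<noteq> {}"
    using assms N(2) by (metis closure_iff_nhds_not_empty disjoint_iff image_eqI subset_refl)
  then show False using N(3) by auto
qed

text \<open>\<open>P\<close> crosses the strip sideways while \<open>Z\<close> reaches below and
  above it, so planar separation forces a meeting. Both are prolonged to the sides of a square in
  order to apply \<open>fashoda\<close>.\<close>

lemma crosses_strip:
  assumes Z: "connected Z" "Z \<subseteq> {z. 0 < Re z \<and> Re z < b}"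
    and P: "path P" "Re (pathstart P) \<le> 0" "b \<le> Re (pathfinish P)"
    and z1: "z1 \<in> Z" "\<And>p. p \<in> path_image P \<Longrightarrow> Im z1 < Im p"
    and z2: "z2 \<in> Z" "\<And>p. p \<in> path_image P \<Longrightarrow> Im p < Im z2"
  shows "Z \<inter> path_image P \<noteq> {}"
proof
  assume dis: "Z \<inter> path_image P = {}"
  \<comment> \<open>\<open>Z\<close> need not be path connected. If it missed \<open>P\<close> it
    would lie in the open set \<open>S\<close>, where its two points can be joined by a path
    \<open>g\<close>.\<close>
  define S where "S = {z. 0 < Re z \<and> Re z < b} - path_image P"
  have "open {z. 0 < Re z \<and> Re z < b}"
    by (intro open_Collect_conj open_Collect_less continuous_intros)
  then have "open S" unfolding S_def using P(1) by (intro open_Diff closed_path_image)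
  have "connected_component S z1 z2"
    using Z dis z1(1) z2(1) unfolding connected_component_def S_def by blast
  then have "path_component S z1 z2"
    using \<open>open S\<close> by (simp add: open_path_connected_component)
  then obtain g where g: "path g" "path_image g \<subseteq> S" "pathstart g = z1" "pathfinish g = z2"
    unfolding path_component_def by blast
  have "bounded (path_image P \<union> path_image g)"
    using P(1) g(1) by (simp add: bounded_path_image)
  then obtain R where R: "\<And>z. z \<in> path_image P \<union> path_image g \<Longrightarrow> norm z \<le> R"
    unfolding bounded_iff by blast
  then have box: "\<bar>Re z\<bar> \<le> R" "\<bar>Im z\<bar> \<le> R" if "z \<in> path_image P \<union> path_image g" for z
    using that abs_Re_le_cmod abs_Im_le_cmod order_trans by blast+
  define ps pf where "ps = pathstart P" and "pf = pathfinish P"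
  have ends: "ps \<in> path_image P" "pf \<in> path_image P" "z1 \<in> path_image g" "z2 \<in> path_image g"
    using g by (auto simp: ps_def pf_def)
  have in1: "\<bar>Re ps\<bar> \<le> R" "\<bar>Im ps\<bar> \<le> R" "\<bar>Re pf\<bar> \<le> R" "\<bar>Im pf\<bar> \<le> R"
     "\<bar>Re z1\<bar> \<le> R" "\<bar>Im z1\<bar> \<le> R" "\<bar>Re z2\<bar> \<le> R" "\<bar>Im z2\<bar> \<le> R"
    using box ends by blast+
  \<comment> \<open>Horizontal segments prolong \<open>P\<close> to the left and right sides of the
    square of half-width \<open>R\<close>, vertical ones prolong \<open>g\<close> to its bottom and
    top.\<close>
  define f1 f2 g1 g2 where "f1 = linepath (Complex (-R) (Im ps)) ps"
    and "f2 = linepath pf (Complex R (Im pf))"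
    and "g1 = linepath (Complex (Re z1) (-R)) z1" and "g2 = linepath z2 (Complex (Re z2) R)"
  have if1: "path_image f1 = {z. Im z = Im ps \<and> Re z \<in> {-R..Re ps}}"
    and if2: "path_image f2 = {z. Im z = Im pf \<and> Re z \<in> {Re pf..R}}"
    and ig1: "path_image g1 = {z. Re z = Re z1 \<and> Im z \<in> {-R..Im z1}}"
    and ig2: "path_image g2 = {z. Re z = Re z2 \<and> Im z \<in> {Im z2..R}}"
    using in1 by (auto simp: f1_def f2_def g1_def g2_def closed_segment_same_Im closed_segment_same_Re
        closed_segment_eq_real_ivl)
  define F G where "F = f1 +++ P +++ f2" and "G = g1 +++ g +++ g2"
  have pF: "path F" "path_image F = path_image f1 \<union> path_image P \<union> path_image f2"
    and pG: "path G" "path_image G = path_image g1 \<union> path_image g \<union> path_image g2"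
    using P(1) g by (auto simp: F_def G_def f1_def f2_def g1_def g2_def ps_def pf_def path_image_join)
  have "path_image F \<inter> path_image G = {}"
  proof -
    \<comment> \<open>\<open>f1\<close> and \<open>f2\<close> stay outside the open strip, which
      contains all of \<open>G\<close>; \<open>g1\<close> and \<open>g2\<close> stay strictly below
      and above \<open>P\<close>.\<close>
    have "path_image f1 \<inter> path_image G = {}" "path_image f2 \<inter> path_image G = {}"
      using g(2) P(2,3) ends Z(2) z1 z2 unfolding pG if1 if2 ig1 ig2 S_def
      by (auto simp: ps_def pf_def)
    moreover have "path_image P \<inter> path_image G = {}"
      using g(2) z1(2) z2(2) unfolding pG ig1 ig2 S_def by fastforce
    ultimately show ?thesis unfolding pF(2) by blast
  qed
  define \<phi> :: "complex \<Rightarrow> real^2" where "\<phi> z = vector [Re z, Im z]" for z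
  have \<phi>12: "\<phi> z $ 1 = Re z" "\<phi> z $ 2 = Im z" for z by (auto simp: \<phi>_def)
  have inj: "\<phi> z = \<phi> w \<Longrightarrow> z = w" for z w by (metis \<phi>12 complex_eq_iff)
  have cont: "continuous_on A \<phi>" for A
  proof -
    have "continuous_on A (\<lambda>z. \<chi> i::2. if i = 1 then Re z else Im z)"
    proof (rule continuous_on_vec_lambda)
      show "continuous_on A (\<lambda>z. if i = 1 then Re z else Im z)" for i :: 2
        by (cases "i = 1") (auto intro: continuous_intros)
    qed
    moreover have "\<phi> = (\<lambda>z. \<chi> i::2. if i = 1 then Re z else Im z)"
      by (auto simp: fun_eq_iff vec_eq_iff forall_2 \<phi>12)
    ultimately show ?thesis by simp
  qed
  define a c :: "real^2" where "a = vector [-R, -R]" and "c = vector [R, R]"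
  have sub: "\<phi> ` A \<subseteq> cbox a c" if "\<And>z. z \<in> A \<Longrightarrow> \<bar>Re z\<bar> \<le> R \<and> \<bar>Im z\<bar> \<le> R" for A
  proof (rule image_subsetI)
    show "\<phi> z \<in> cbox a c" if "z \<in> A" for z
      using \<open>\<And>z. z \<in> A \<Longrightarrow> \<bar>Re z\<bar> \<le> R \<and> \<bar>Im z\<bar> \<le> R\<close>[OF that]
      by (simp add: mem_box_cart a_def c_def \<phi>12 forall_2 abs_le_iff)
  qed
  have bF: "\<bar>Re z\<bar> \<le> R \<and> \<bar>Im z\<bar> \<le> R" if z: "z \<in> path_image F" for z
  proof -
    consider "z \<in> path_image f1" | "z \<in> path_image P" | "z \<in> path_image f2"
      using z unfolding pF(2) by blast
    then show ?thesis
    proof cases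
      case 1 then show ?thesis using in1 unfolding if1 by (simp add: abs_le_iff)
    next
      case 2 then show ?thesis using box by blast
    next
      case 3 then show ?thesis using in1 unfolding if2 by (simp add: abs_le_iff)
    qed
  qed
  have bG: "\<bar>Re z\<bar> \<le> R \<and> \<bar>Im z\<bar> \<le> R" if z: "z \<in> path_image G" for z
  proof -
    consider "z \<in> path_image g1" | "z \<in> path_image g" | "z \<in> path_image g2"
      using z unfolding pG(2) by blast
    then show ?thesis
    proof cases
      case 1 then show ?thesis using in1 unfolding ig1 by (simp add: abs_le_iff)
    next
      case 2 then show ?thesis using box by blast
    next
      case 3 then show ?thesis using in1 unfolding ig2 by (simp add: abs_le_iff)
    qed
  qed
  obtain y where "y \<in> path_image (\<phi> \<circ> F)" "y \<in> path_image (\<phi> \<circ> G)"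
  proof (rule fashoda[of "\<phi> \<circ> F" "\<phi> \<circ> G" a c])
    show "path (\<phi> \<circ> F)" "path (\<phi> \<circ> G)" using pF(1) pG(1) cont by (auto intro: path_continuous_image)
    show "path_image (\<phi> \<circ> F) \<subseteq> cbox a c" "path_image (\<phi> \<circ> G) \<subseteq> cbox a c"
      unfolding path_image_compose using sub bF bG by blast+
  qed (auto simp: pathstart_compose pathfinish_compose \<phi>12 a_def c_def F_def G_def f1_def f2_def g1_def g2_def)
  then obtain z w where "z \<in> path_image F" "w \<in> path_image G" "\<phi> z = \<phi> w"
    unfolding path_image_compose by auto
  then show False using inj \<open>path_image F \<inter> path_image G = {}\<close> by blast
qed

text \<open>A cofrontier only provides two unnamed sides. If one side contained both 1 and 2, it
  would absorb the disc, the exterior and both components of the annulus off \<Psi>, leaving the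
  other side empty and without frontier.\<close>

lemma essential_cofrontier_sides:
  assumes "cofrontier \<Psi>" "essential \<Psi>"
  obtains U V where "open U" "open V" "connected U" "connected V" "U \<inter> V = {}" "U \<union> V = - \<Psi>"
    "frontier U = \<Psi>" "frontier V = \<Psi>" "cball 0 1 \<subseteq> U" "- ball 0 2 \<subseteq> V"
proof -
  obtain U V where UV: "open U" "open V" "connected U" "connected V" "U \<inter> V = {}" "U \<union> V = - \<Psi>"
    "frontier U = \<Psi>" "frontier V = \<Psi>" and ne: "\<Psi> \<noteq> {}"
    using assms(1) unfolding cofrontier_def by blast
  obtain C1 C2 where C: "components (annulus - \<Psi>) = {C1, C2}"
     "sphere 0 1 \<subseteq> C1" "sphere 0 2 \<subseteq> C2" and int: "\<Psi> \<subseteq> annulus_interior"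
    using assms(2) unfolding essential_def by blast
  have conC: "connected C1" "connected C2" and unC: "C1 \<union> C2 = annulus - \<Psi>"
    using in_components_connected[of C1] in_components_connected[of C2] C(1)
      Union_components[of "annulus - \<Psi>"] by auto
  have side: "D \<subseteq> A" if "connected D" "D \<inter> A \<noteq> {}" "D \<subseteq> A \<union> B" "open A" "open B" "A \<inter> B = {}"
    for A B D :: "complex set"
    using connectedD[OF that(1,4,5)] that by blast
  have con1: "connected (cball (0::complex) 1)" by simp
  have con2: "connected (- ball (0::complex) 2)"
    by (rule connected_complement_bounded_convex) auto
  have out1: "cball 0 1 \<subseteq> - \<Psi>" and out2: "- ball 0 2 \<subseteq> - \<Psi>"
    using int by (auto simp: annulus_interior_def)
  have one: "(1::complex) \<in> cball 0 1" "(2::complex) \<in> - ball 0 2" "1 \<in> C1" "2 \<in> C2"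
    using C by auto
  have same: False if "open A" "open B" "A \<inter> B = {}" "A \<union> B = - \<Psi>" "frontier B = \<Psi>"
     "1 \<in> A" "2 \<in> A" for A B
  proof -
    have "cball 0 1 \<subseteq> A" "- ball 0 2 \<subseteq> A" "C1 \<subseteq> A" "C2 \<subseteq> A"
      using side[OF con1, of A B] side[OF con2, of A B] side[OF conC(1), of A B]
        side[OF conC(2), of A B] that one unC out1 out2 by blast+
    moreover have "- \<Psi> \<subseteq> cball 0 1 \<union> - ball 0 2 \<union> (C1 \<union> C2)"
      unfolding unC annulus_def by auto
    ultimately have "B = {}" using that by blast
    then show False using that ne by simp
  qed
  have "1 \<in> U \<union> V" "2 \<in> U \<union> V" using UV(6) one out1 out2 by blast+
  then consider "1 \<in> U" "2 \<in> V" | "1 \<in> V" "2 \<in> U"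
    using same[of U V] same[of V U] UV by (auto simp: Un_commute Int_commute)
  then show ?thesis
  proof cases
    case 1
    have "cball 0 1 \<subseteq> U" using side[OF con1, of U V] UV out1 one 1 by blast
    moreover have "- ball 0 2 \<subseteq> V" using side[OF con2, of V U] UV out2 one 1 by blast
    ultimately show ?thesis using that UV by blast
  next
    case 2
    have "cball 0 1 \<subseteq> V" using side[OF con1, of V U] UV out1 one 2 by blast
    moreover have "- ball 0 2 \<subseteq> U" using side[OF con2, of U V] UV out2 one 2 by blast
    ultimately show ?thesis using that[of V U] UV by (simp add: Un_commute Int_commute)
  qed
qed

text \<open>\<open>U\<close> is the side around the hole of the annulus and \<open>V\<close> the
  unbounded one; in the lift they extend the left and the right half plane bounding the
  strip.\<close>

locale essential_cofrontier =
  fixes \<Psi> U V :: "complex set"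
  assumes open_U: "open U" and open_V: "open V" and connected_U: "connected U"
    and connected_V: "connected V" and disjoint_UV: "U \<inter> V = {}" and Un_UV: "U \<union> V = - \<Psi>"
    and frontier_U: "frontier U = \<Psi>" and frontier_V: "frontier V = \<Psi>"
    and inner: "cball 0 1 \<subseteq> U" and outer: "- ball 0 2 \<subseteq> V"
    and nonempty: "\<Psi> \<noteq> {}"
begin

abbreviation lift :: "complex set" where "lift \<equiv> exp -` \<Psi>"

lemma closed_\<Psi>: "closed \<Psi>" using frontier_U frontier_closed by metis

lemma norm_\<Psi>: "z \<in> \<Psi> \<Longrightarrow> 1 < cmod z \<and> cmod z < 2"
proof -
  assume "z \<in> \<Psi>"
  then have "z \<notin> U \<union> V" using Un_UV by blast
  then have "z \<notin> cball 0 1" "z \<notin> - ball 0 2" using inner outer by blast+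
  then show ?thesis by auto
qed

lemma zero_notin: "0 \<notin> \<Psi>" using norm_\<Psi>[of 0] by auto

lemma closed_lift: "closed lift"
  by (intro closed_vimage closed_\<Psi> continuous_intros)

lemma lift_nonempty: "lift \<noteq> {}"
proof -
  obtain z where "z \<in> \<Psi>" using nonempty by blast
  then have "exp (Ln z) = z" using zero_notin by (metis exp_Ln)
  then show ?thesis using \<open>z \<in> \<Psi>\<close> by (metis empty_iff vimageI)
qed

lemma lift_strip: "lift \<subseteq> {z. 0 < Re z \<and> Re z < ln 2}"
proof
  fix w assume "w \<in> lift"
  then have "1 < exp (Re w) \<and> exp (Re w) < 2" using norm_\<Psi>[of "exp w"] by simp
  then show "w \<in> {z. 0 < Re z \<and> Re z < ln 2}"
    by (metis exp_less_cancel_iff exp_ln exp_zero mem_Collect_eq zero_less_numeral)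
qed

lemma half_plane_U: "{w. Re w \<le> 0} \<subseteq> exp -` U"
  using inner by (auto simp: subset_iff)

lemma half_plane_V: "{w. ln 2 \<le> Re w} \<subseteq> exp -` V"
proof
  fix w assume "w \<in> {w. ln 2 \<le> Re w}"
  then have "2 \<le> exp (Re w)" by (metis exp_le_cancel_iff exp_ln mem_Collect_eq zero_less_numeral)
  then have "exp w \<in> - ball 0 2" by simp
  then show "w \<in> exp -` V" using outer by blast
qed

text \<open>\<open>exp\<close> is a covering only over the punctured plane, and removing 0 leaves
  the preimage unchanged. The base point 1 is convenient because all its logarithms lie on the
  imaginary axis.\<close>

lemma connected_lift_U: "connected (exp -` U)"
proof -
  have "connected (exp -` (U - {0}) :: complex set)"
  proof (rule connected_exp_vimage)
    show "path_connected (U - {0})"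
      using open_U connected_U by (intro path_connected_open_delete) auto
    show "connected {w. Re w \<le> 0}" by (intro convex_connected convex_halfspace_Re_le)
    show "{w. Re w \<le> 0} \<subseteq> exp -` (U - {0})" using half_plane_U by auto
    show "1 \<in> U - {0}" using inner by auto
    show "exp -` {1::complex} \<subseteq> {w. Re w \<le> 0}" by (auto simp: exp_eq_1)
  qed auto
  moreover have "exp -` (U - {0}) = exp -` U" by auto
  ultimately show ?thesis by simp
qed

lemma connected_lift_V: "connected (exp -` V)"
proof (rule connected_exp_vimage)
  show "path_connected V" using open_V connected_V by (simp add: connected_open_path_connected)
  have "0 \<in> U" using inner by auto
  then have "0 \<notin> V" using disjoint_UV by blast
  then show "V \<subseteq> - {0}" by auto
  show "connected {w. ln 2 \<le> Re w}"
    using convex_connected[OF convex_halfspace_Re_ge[of "ln 2"]] by simp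
  show "{w. ln 2 \<le> Re w} \<subseteq> exp -` V" by (rule half_plane_V)
  show "2 \<in> V" using outer by auto
  show "exp -` {2::complex} \<subseteq> {w. ln 2 \<le> Re w}"
  proof
    fix w :: complex assume "w \<in> exp -` {2}"
    then have "norm (exp w) = norm (2::complex)" by simp
    then have "exp (Re w) = 2" by simp
    then show "w \<in> {w. ln 2 \<le> Re w}" by (metis ln_exp mem_Collect_eq order_refl)
  qed
qed

lemma open_lift_UV: "open (exp -` U)" "open (exp -` V)"
  by (auto intro!: open_vimage open_U open_V continuous_intros)

lemma lift_closures: "lift \<subseteq> closure (exp -` U)" "lift \<subseteq> closure (exp -` V)"
  using closure_exp_vimage[of _ U] closure_exp_vimage[of _ V] frontier_U frontier_V
  by (auto simp: frontier_def)

lemma lift_complement: "- lift = exp -` U \<union> exp -` V"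
  using Un_UV by auto

lemma connected_lift: "connected lift"
proof -
  have dis: "closure (exp -` U) \<inter> exp -` V = {}" "closure (exp -` V) \<inter> exp -` U = {}"
    using open_lift_UV disjoint_UV
    by (metis Int_commute disjoint_iff open_Int_closure_eq_empty vimage_Int vimage_empty)+
  \<comment> \<open>Both sides accumulate at every point of \<Psi>, hence their lifts at every point
    of \<open>lift\<close>: this is where the common frontier enters.\<close>
  then have "closure (exp -` U) \<inter> closure (exp -` V) = lift"
    using lift_closures lift_complement by blast
  moreover have "UNIV = closure (exp -` U) \<union> closure (exp -` V)"
    using lift_closures lift_complement closure_subset[of "exp -` U"] closure_subset[of "exp -` V"]
    by blast
  ultimately show ?thesis
    using unicoherentD[OF unicoherent_UNIV, of "closure (exp -` U)" "closure (exp -` V)"]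
      connected_lift_U connected_lift_V by (simp add: connected_imp_connected_closure)
qed

text \<open>A ball around \<open>w\<close> off \<open>K\<close> meets the lifts of both sides, so it
  bridges them to a connected open set \<open>D\<close> that avoids \<open>K\<close> and contains
  both half planes bounding the strip.\<close>

lemma path_through_gap:
  assumes "closed K" "w \<in> lift" "w \<notin> K" "K \<subseteq> lift"
  obtains P where "path P" "Re (pathstart P) \<le> 0" "ln 2 \<le> Re (pathfinish P)" "path_image P \<inter> K = {}"
proof -
  obtain e where e: "e > 0" "ball w e \<subseteq> - K"
    using assms(1,3) by (meson Compl_iff open_Compl open_contains_ball)
  define D where "D = (exp -` U \<union> ball w e) \<union> (exp -` V \<union> ball w e)"
  have "ball w e \<inter> exp -` U \<noteq> {}" "ball w e \<inter> exp -` V \<noteq> {}"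
    using lift_closures assms(2) e(1) open_Int_closure_eq_empty[OF open_ball, of w e]
      centre_in_ball[of w e] by blast+
  then have "connected D"
    unfolding D_def using connected_lift_U connected_lift_V e(1)
    by (intro connected_Un connected_ball) auto
  moreover have "open D" unfolding D_def using open_lift_UV by auto
  ultimately have "path_connected D" by (simp add: connected_open_path_connected)
  moreover have "0 \<in> D" "of_real (ln 2) \<in> D"
    using subsetD[OF half_plane_U, of 0] subsetD[OF half_plane_V, of "of_real (ln 2)"]
    unfolding D_def by simp_all
  ultimately obtain P where P: "path P" "path_image P \<subseteq> D" "pathstart P = 0" "pathfinish P = of_real (ln 2)"
    unfolding path_connected_def by blast
  have "D \<inter> K = {}" using e(2) assms(4) lift_complement unfolding D_def by blast
  then show ?thesis using that[of P] P by auto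
qed

end

section \<open>Plane continua on which exp is injective\<close>

text \<open>Boundary bumping: the component of \<open>z\<close> in \<open>Y\<close> minus a small
  ball about \<open>x\<close> reaches the frontier of what is left, hence comes close to
  \<open>x\<close>.\<close>

lemma composant_dense:
  fixes Y :: "'a::metric_space set"
  assumes Y: "compact Y" "connected Y" "z \<in> Y" "x \<in> Y" "Y \<noteq> {z}" and e: "e > 0"
  obtains A where "compact A" "connected A" "z \<in> A" "A \<subset> Y" "A \<inter> ball x e \<noteq> {}"
proof (cases "z \<in> ball x e")
  case True
  then show ?thesis using that[of "{z}"] Y by auto
next
  case False
  \<comment> \<open>Radius \<open>e/2\<close>, since the bumping point is only known to lie in the
    closed ball.\<close>
  define C where "C = Y - ball x (e/2)"
  define A where "A = connected_component_set C z"
  have zC: "z \<in> C" using False Y e by (auto simp: C_def)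
  have clC: "closedin (top_of_set Y) C"
    using closedin_closed_Int[of "- ball x (e/2)" Y] by (simp add: C_def Diff_eq closed_Compl)
  have compC: "compact C" unfolding C_def using Y(1) by (simp add: compact_diff)
  have "compact A" unfolding A_def using compC
    by (metis closed_connected_component compact_Int_closed compact_imp_closed connected_component_subset
        inf.absorb_iff2)
  have "A \<in> connected_components_of (subtopology (top_of_set Y) C)"
  proof -
    have "subtopology (top_of_set Y) C = top_of_set C"
      by (simp add: subtopology_subtopology C_def Int_absorb1)
    moreover have "A = connected_component_of_set (top_of_set C) z"
      by (auto simp: A_def connected_component_of_def connected_component_def connectedin_subtopology)
    ultimately show ?thesis
      using zC connected_component_in_connected_components_of[of "top_of_set C" z] by simp
  qed
  moreover have "x \<notin> C" using e by (simp add: C_def)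
  then have "C \<noteq> topspace (top_of_set Y)" using Y(4) by auto
  ultimately have "A \<inter> (top_of_set Y) frontier_of C \<noteq> {}"
    using boundary_bumping_theorem_closed[of "top_of_set Y" C A] Y clC
    by (simp add: compact_space_subtopology Hausdorff_space_subtopology flip: connectedin_topspace)
  then obtain a where a: "a \<in> A" "a \<in> (top_of_set Y) closure_of (Y - C)"
    by (auto simp: frontier_of_closures)
  have "Y - C \<subseteq> cball x (e/2)" by (auto simp: C_def)
  then have "closure (Y - C) \<subseteq> cball x (e/2)" by (simp add: closure_minimal)
  moreover have "a \<in> closure (Y - C)" using a(2) by (auto simp: closure_of_subtopology Int_absorb1)
  ultimately have "a \<in> ball x e" using e by auto
  show ?thesis
  proof (rule that[of A])
    show "connected A" "z \<in> A" using zC by (auto simp: A_def)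
    have "A \<subseteq> C" by (simp add: A_def connected_component_subset)
    then show "A \<subset> Y" using Y(4) \<open>x \<notin> C\<close> by (auto simp: C_def)
  qed (use \<open>compact A\<close> a \<open>a \<in> ball x e\<close> in auto)
qed

text \<open>Failure of injectivity of \<open>exp\<close> is thus witnessed at a fixed distance,
  which makes it stable under limits.\<close>

lemma exp_eq_dist:
  assumes "exp z = exp w" "z \<noteq> (w::complex)"
  shows "2 * pi \<le> dist z w"
proof -
  obtain n :: int where n: "z = w + of_int (2 * n) * pi * \<i>" using assms(1) by (auto simp: exp_eq)
  then have "n \<noteq> 0" using assms(2) by auto
  then have "1 \<le> real_of_int \<bar>n\<bar>" by linarith
  moreover have "dist z w = 2 * pi * real_of_int \<bar>n\<bar>"
    by (simp add: dist_norm n norm_mult)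
  ultimately show ?thesis by simp
qed

text \<open>The inverse of \<open>exp\<close> on \<open>B\<close> is a branch of the logarithm.
  Composed with \<open>exp\<close> on \<open>A\<close> it is a lift of \<open>exp\<close> that
  agrees with the identity at \<open>w\<close>, so uniqueness of lifts makes it the identity on
  \<open>A\<close>.\<close>

lemma exp_lift_unique:
  fixes A B :: "complex set"
  assumes A: "connected A" and B: "compact B" "inj_on exp B" and sub: "exp ` A \<subseteq> exp ` B"
    and w: "w \<in> A" "w \<in> B"
  shows "A \<subseteq> B"
proof
  fix a assume "a \<in> A"
  define l where "l = inv_into B exp"
  have contl: "continuous_on (exp ` B) l"
    unfolding l_def using B by (intro continuous_on_inv continuous_intros) auto
  have cont: "continuous_on A (\<lambda>x. l (exp x))"
    by (rule continuous_on_compose2[OF contl, of A exp]) (use sub in \<open>auto intro: continuous_intros\<close>)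
  have lB: "l (exp x) \<in> B" "exp (l (exp x)) = exp x" if "x \<in> A" for x
  proof -
    have "exp x \<in> exp ` B" using that sub by blast
    then show "l (exp x) \<in> B" "exp (l (exp x)) = exp x"
      unfolding l_def by (rule inv_into_into, rule f_inv_into_f)
  qed
  have "(\<lambda>x. x) a = (\<lambda>x. l (exp x)) a"
  proof (rule covering_space_lift_unique[OF covering_space_exp_punctured_plane, of "\<lambda>x. x" w _ A exp])
    show "w = l (exp w)" using w B(2) by (simp add: l_def)
    show "connected A" "w \<in> A" "a \<in> A" by fact+
    show "continuous_on A (\<lambda>x. l (exp x))" by (rule cont)
    show "exp x = exp (l (exp x))" if "x \<in> A" for x using lB[OF that] by simp
  qed (auto intro: continuous_intros)
  then show "a \<in> B" using lB[OF \<open>a \<in> A\<close>] by simp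
qed

text \<open>In a minimal continuum \<open>Y\<close> on which \<open>exp\<close> fails to be injective, all proper subcontinua
  embed into \<open>\<Psi>\<close>. If \<open>z\<close> and \<open>z + p\<close> lie in \<open>Y\<close> and \<open>A\<close> is a proper subcontinuum through \<open>z\<close> reaching
  nearly as far up as \<open>Y\<close>, then \<open>A + p\<close> sticks out of \<open>Y\<close>, so by nestedness it swallows every
  proper subcontinuum through \<open>z + p\<close>; these are dense in \<open>Y\<close>.\<close>

lemma exp_inj_on_if_nested:
  fixes Z :: "complex set"
  assumes nested: "\<And>A B. \<lbrakk>compact A; connected A; compact B; connected B; A \<subseteq> \<Psi>; B \<subseteq> \<Psi>; A \<inter> B \<noteq> {}\<rbrakk>
      \<Longrightarrow> A \<subseteq> B \<or> B \<subseteq> A"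
    and Z: "compact Z" "connected Z" "exp ` Z \<subseteq> \<Psi>"
  shows "inj_on exp Z"
proof (rule ccontr)
  assume ninj: "\<not> inj_on exp Z"
  \<comment> \<open>The bound \<open>2 * pi\<close> makes the set of offending pairs closed, so
    \<open>bad\<close> survives decreasing intersections, as
    \<open>Brouwer_reduction_theorem_gen\<close> requires.\<close>
  define bad where "bad Y \<longleftrightarrow> compact Y \<and> connected Y \<and>
      (\<exists>z\<in>Y. \<exists>w\<in>Y. exp z = exp w \<and> 2 * pi \<le> dist z w)" for Y :: "complex set"
  have badI: "bad Y" if "compact Y" "connected Y" "\<not> inj_on exp Y" for Y
    using that exp_eq_dist unfolding bad_def inj_on_def by blast
  have "closed Z" using Z(1) by (rule compact_imp_closed)
  moreover have "bad Z" using badI Z ninj by blast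
  moreover have "bad (\<Inter>(range F))" if F: "\<And>n. closed (F n)" "\<And>n. bad (F n)" "\<And>n. F (Suc n) \<subseteq> F n" for F
  proof -
    have mono: "F n \<subseteq> F m" if "m \<le> n" for m n
      using lift_Suc_antimono_le[of F, OF F(3) that] .
    have com: "compact (F n)" "connected (F n)" for n using F(2) by (auto simp: bad_def)
    define D where "D n = (F n \<times> F n) \<inter> {p. exp (fst p) = exp (snd p) \<and> 2 * pi \<le> dist (fst p) (snd p)}" for n
    have "closed {p :: complex \<times> complex. exp (fst p) = exp (snd p) \<and> 2 * pi \<le> dist (fst p) (snd p)}"
      by (intro closed_Collect_conj closed_Collect_eq closed_Collect_le continuous_intros)
    then have "compact (D n)" for n
      unfolding D_def using com by (intro compact_Int_closed compact_Times) auto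
    moreover have "D n \<noteq> {}" for n using F(2)[of n] unfolding bad_def D_def by fastforce
    moreover have "D n \<subseteq> D m" if "m \<le> n" for m n using mono[OF that] by (auto simp: D_def)
    ultimately have "\<Inter>(range D) \<noteq> {}" by (rule compact_nest)
    then obtain z w where "\<And>n. (z, w) \<in> D n" by fast
    then have "z \<in> \<Inter>(range F)" "w \<in> \<Inter>(range F)" "exp z = exp w" "2 * pi \<le> dist z w"
      by (auto simp: D_def)
    moreover have "compact (\<Inter>(range F))"
      using com(1) F(1) by (metis (no_types) INF_lower UNIV_I closed_INT compact_Int_closed inf.absorb_iff2)
    moreover have "connected (\<Inter>(range F))" using com mono by (intro connected_nest)
    ultimately show ?thesis unfolding bad_def by blast
  qed
  ultimately obtain Y where Y: "Y \<subseteq> Z" "closed Y" "bad Y"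
      and min: "\<And>W. \<lbrakk>W \<subseteq> Z; closed W; bad W\<rbrakk> \<Longrightarrow> \<not> W \<subset> Y"
    using Brouwer_reduction_theorem_gen[of Z bad] by blast
  have compY: "compact Y" "connected Y" using Y(3) by (auto simp: bad_def)
  have inj: "inj_on exp A" if "compact A" "connected A" "A \<subset> Y" for A
    using that min[of A] badI[of A] Y(1) compact_imp_closed by blast
  obtain z w where zw: "z \<in> Y" "w \<in> Y" "exp z = exp w" "Im z < Im w"
  proof -
    obtain z w where zw: "z \<in> Y" "w \<in> Y" "exp z = exp w" "2 * pi \<le> dist z w"
      using Y(3) by (auto simp: bad_def)
    then have "z \<noteq> w" using pi_gt_zero by (auto simp del: pi_gt_zero)
    obtain n :: int where "z = w + of_int (2 * n) * pi * \<i>" using zw(3) by (auto simp: exp_eq)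
    then have "Re z = Re w" by simp
    then have "Im z < Im w \<or> Im w < Im z" using \<open>z \<noteq> w\<close> by (auto simp: complex_eq_iff)
    then show ?thesis using that zw by metis
  qed
  define p where "p = w - z"
  have p: "w = p + z" "Im p > 0" "exp (p + x) = exp x" for x
    using zw by (auto simp: p_def exp_diff exp_add)
  \<comment> \<open>If \<open>A\<close> contains \<open>z\<close>, then \<open>sh A\<close> is a
    second lift of the image of \<open>A\<close> under \<open>exp\<close>, now through
    \<open>w\<close>.\<close>
  define sh where "sh A = (+) p ` A" for A
  have cont_Im: "continuous_on Y Im" by (intro continuous_intros)
  obtain x where x: "x \<in> Y" "\<And>y. y \<in> Y \<Longrightarrow> Im y \<le> Im x"
    using continuous_attains_sup[OF compY(1) _ cont_Im] zw(1) by blast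
  obtain y0 where y0: "y0 \<in> Y" "\<And>y. y \<in> Y \<Longrightarrow> Im y0 \<le> Im y"
    using continuous_attains_inf[OF compY(1) _ cont_Im] zw(1) by blast
  have nsing: "Y \<noteq> {z}" "Y \<noteq> {w}" using zw by auto
  \<comment> \<open>Radius \<open>Im p\<close>: a point of \<open>A\<close> this close to the
    highest point \<open>x\<close> is pushed above all of \<open>Y\<close> by the
    translation.\<close>
  obtain A where A: "compact A" "connected A" "z \<in> A" "A \<subset> Y" "A \<inter> ball x (Im p) \<noteq> {}"
    using composant_dense[OF compY zw(1) x(1) nsing(1) p(2)] by blast
  have "connected (sh A)"
    unfolding sh_def using A(2) by (intro connected_continuous_image continuous_intros)
  then have shA: "compact (sh A)" "connected (sh A)" "w \<in> sh A" "exp ` sh A = exp ` A" "inj_on exp (sh A)"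
    using A inj[of A] p unfolding sh_def
    by (auto simp: compact_translation image_image inj_on_def image_iff)
  have out: "\<not> sh A \<subseteq> Y"
  proof -
    obtain a where a: "a \<in> A" "dist x a < Im p" using A(5) by auto
    have "\<bar>Im x - Im a\<bar> \<le> dist x a" using abs_Im_le_cmod[of "x - a"] by (simp add: dist_norm)
    then have "Im (p + a) > Im x" using a(2) by simp
    then show ?thesis using x(2) a(1) unfolding sh_def by (meson image_eqI not_le subsetD)
  qed
  have "Y \<subseteq> sh A"
  proof (rule ccontr)
    assume "\<not> Y \<subseteq> sh A"
    then obtain y where y: "y \<in> Y" "y \<notin> sh A" by blast
    have "open (- sh A)" using shA(1) by (simp add: compact_imp_closed open_Compl)
    then obtain e where e: "e > 0" "ball y e \<subseteq> - sh A"
      using y(2) open_contains_ball by (metis ComplI)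
    obtain B where B: "compact B" "connected B" "w \<in> B" "B \<subset> Y" "B \<inter> ball y e \<noteq> {}"
      using composant_dense[OF compY zw(2) y(1) nsing(2) e(1)] by blast
    have "exp ` A \<subseteq> \<Psi>" "exp ` B \<subseteq> \<Psi>" using A(4) B(4) Y(1) Z(3) by blast+
    moreover have "exp w \<in> exp ` A \<inter> exp ` B" using A(3) B(3) zw(3) by (metis IntI imageI)
    ultimately have "exp ` A \<subseteq> exp ` B \<or> exp ` B \<subseteq> exp ` A"
      using A B by (intro nested compact_continuous_image connected_continuous_image continuous_intros) auto
    \<comment> \<open>Nestedness of the images carries over to the two lifts through
      \<open>w\<close>. One inclusion contradicts \<open>out\<close>, the other the choice of
      \<open>B\<close> near \<open>y\<close>.\<close>
    then have "sh A \<subseteq> B \<or> B \<subseteq> sh A"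
      using exp_lift_unique[of "sh A" B w] exp_lift_unique[of B "sh A" w] shA B inj[of B] by auto
    then show False using out B e by blast
  qed
  \<comment> \<open>The lowest point of \<open>Y\<close> cannot lie in an upward translate of a
    subset of \<open>Y\<close>.\<close>
  then obtain a where "a \<in> A" "y0 = p + a" using y0(1) by (auto simp: sh_def)
  then show False using y0(2)[of a] A(4) p(2) by auto
qed

context essential_cofrontier
begin

lemma lift_shift: "w + of_int n * (2 * of_real pi * \<i>) \<in> lift \<longleftrightarrow> w \<in> lift"
proof -
  have "exp (w + of_int n * (2 * of_real pi * \<i>)) = exp w"
    by (subst exp_eq) (auto intro!: exI[of _ n] simp: mult_ac)
  then show ?thesis by simp
qed

text \<open>Otherwise the inverse of \<open>exp\<close> on \<open>Z\<close> is a continuous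
  logarithm \<open>l\<close> on \<Psi>. The difference \<open>w - l (exp w)\<close> takes discrete
  values on the connected \<open>lift\<close>, so it is constant, yet it grows by
  \<open>2 * pi * \<i>\<close> under a deck translation.\<close>

lemma exp_image_ne:
  assumes Z: "compact Z" "inj_on exp Z"
  shows "exp ` Z \<noteq> \<Psi>"
proof
  assume eq: "exp ` Z = \<Psi>"
  define l where "l = inv_into Z exp"
  have contl: "continuous_on \<Psi> l"
    unfolding l_def eq[symmetric] using Z by (intro continuous_on_inv continuous_intros) auto
  have "continuous_on lift (\<lambda>w. l (exp w))"
    by (rule continuous_on_compose2[OF contl, of lift exp]) (auto intro: continuous_intros)
  then have cont: "continuous_on lift (\<lambda>w. w - l (exp w))"
    by (intro continuous_on_diff continuous_on_id)
  have el: "exp (w - l (exp w)) = 1" if "w \<in> lift" for w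
  proof -
    have "exp (l (exp w)) = exp w" using that eq unfolding l_def by (auto intro!: f_inv_into_f)
    then show ?thesis by (simp add: exp_diff)
  qed
  have "(\<lambda>w. w - l (exp w)) constant_on lift"
  proof (rule continuous_discrete_range_constant[OF connected_lift cont])
    fix x assume x: "x \<in> lift"
    have "2 * pi \<le> norm (y - l (exp y) - (x - l (exp x)))"
      if "y \<in> lift \<and> y - l (exp y) \<noteq> x - l (exp x)" for y
      using exp_eq_dist[of "y - l (exp y)" "x - l (exp x)"] el[OF x] el[of y] that
      unfolding dist_norm by argo
    then show "\<exists>e>0. \<forall>y. y \<in> lift \<and> y - l (exp y) \<noteq> x - l (exp x)
        \<longrightarrow> e \<le> norm (y - l (exp y) - (x - l (exp x)))"
      by (intro exI[of _ "2 * pi"]) simp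
  qed
  then obtain c where c: "\<And>w. w \<in> lift \<Longrightarrow> w - l (exp w) = c" by (auto simp: constant_on_def)
  obtain w where w: "w \<in> lift" using lift_nonempty by blast
  define w' where "w' = w + of_int 1 * (2 * of_real pi * \<i>)"
  have "w' \<in> lift" unfolding w'_def using lift_shift w by blast
  moreover have "exp w' = exp w" by (simp add: w'_def exp_add)
  ultimately have "w' = w" using c[OF w] c[of w'] by (simp add: diff_eq_eq)
  then show False by (simp add: w'_def)
qed

end

section \<open>The suspension of a minimal flow over an essential cofrontier\<close>

text \<open>\<open>T n\<close> stands for the \<open>n\<close>-th power of the minimal
  homeomorphism. \<open>S\<close> is a subset of the real line so that \<open>emb\<close> can take
  values in a Euclidean space.\<close>

locale minimal_flow =
  fixes S :: "real set" and T :: "int \<Rightarrow> real \<Rightarrow> real"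
  assumes compact_S: "compact S" and S_nonempty: "S \<noteq> {}"
    and totally_disconnected_S: "\<lbrakk>connected D; D \<subseteq> S; a \<in> D; b \<in> D\<rbrakk> \<Longrightarrow> a = b"
    and T_in: "x \<in> S \<Longrightarrow> T n x \<in> S" and continuous_T: "continuous_on S (T n)"
    and T_0: "x \<in> S \<Longrightarrow> T 0 x = x" and T_add: "x \<in> S \<Longrightarrow> T (m + n) x = T m (T n x)"
    and minimal_T: "\<lbrakk>closed K; K \<subseteq> S; K \<noteq> {}; T 1 ` K = K\<rbrakk> \<Longrightarrow> K = S"
begin

lemma T_inverse:
  assumes "x \<in> S"
  shows "T (- n) (T n x) = x" "T n (T (- n) x) = x"
  by (metis T_add[OF assms] T_0[OF assms] add.left_inverse add.right_inverse)+

text \<open>The factor \<open>sin (pi * t)\<close> pinches the fibre at the integers, where the floor jumps;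
  \<open>slot t\<close> and \<open>slot (t + 1 / 2)\<close> are never pinched simultaneously.\<close>

definition slot :: "real \<Rightarrow> real \<Rightarrow> real" where
  "slot t x = \<bar>sin (pi * t)\<bar> * T \<lfloor>t\<rfloor> x"

text \<open>The modulus of the sine has period 1 and the floor grows by \<open>n\<close>, which
  \<open>T (- n)\<close> undoes: \<open>slot\<close> is invariant under the deck action.\<close>

lemma slot_shift:
  assumes "x \<in> S"
  shows "slot (t + of_int n) (T (- n) x) = slot t x"
proof -
  have sn: "sin (pi * of_int n) = 0" using sin_integer_2pi by (simp add: sin_zero_iff_int2)
  then have "\<bar>cos (pi * of_int n)\<bar> = 1" by (rule sin_zero_abs_cos_one)
  then have "\<bar>sin (pi * (t + of_int n))\<bar> = \<bar>sin (pi * t)\<bar>"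
    by (simp add: distrib_left sin_add sn abs_mult)
  moreover have "\<lfloor>t + of_int n\<rfloor> = \<lfloor>t\<rfloor> + n" by simp
  moreover have "T (\<lfloor>t\<rfloor> + n) (T (- n) x) = T \<lfloor>t\<rfloor> x"
    using T_add[OF T_in[OF assms, of "- n"], of "\<lfloor>t\<rfloor>" n] T_inverse(2)[OF assms] by simp
  ultimately show ?thesis by (simp add: slot_def)
qed

text \<open>On each slab between consecutive integers \<open>slot\<close> is a product of continuous
  functions, also at the right end, where the floor jumps but the sine vanishes. Two adjacent slabs
  form a neighbourhood of the given point.\<close>

lemma continuous_slot: "continuous_on (UNIV \<times> S) (\<lambda>p. slot (fst p) (snd p))"
  unfolding continuous_on_eq_continuous_within
proof
  fix p :: "real \<times> real" assume p: "p \<in> UNIV \<times> S"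
  \<comment> \<open>An integer nearest to \<open>fst p\<close>, so that \<open>fst p\<close> is
    interior to the interval from \<open>n - 1\<close> to \<open>n + 1\<close>.\<close>
  define n where "n = \<lfloor>fst p + 1/2\<rfloor>"
  let ?A = "{real_of_int n - 1..real_of_int n} \<times> S" and ?B = "{real_of_int n..real_of_int n + 1} \<times> S"
  have piece: "continuous_on ({real_of_int m..real_of_int m + 1} \<times> S) (\<lambda>p. slot (fst p) (snd p))" for m :: int
  proof -
    have "continuous_on ({real_of_int m..real_of_int m + 1} \<times> S) (\<lambda>p. \<bar>sin (pi * fst p)\<bar> * T m (snd p))"
      by (intro continuous_intros continuous_on_compose2[OF continuous_T]) auto
    moreover have "\<bar>sin (pi * fst q)\<bar> * T m (snd q) = slot (fst q) (snd q)"
      if "q \<in> {real_of_int m..real_of_int m + 1} \<times> S" for q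
    proof (cases "fst q = of_int (m + 1)")
      case True
      then have "sin (pi * fst q) = 0" by (metis mult.commute sin_zero_iff_int2)
      then show ?thesis by (simp add: slot_def)
    next
      case False
      then have "\<lfloor>fst q\<rfloor> = m" using that by (auto simp: floor_eq_iff)
      then show ?thesis by (simp add: slot_def)
    qed
    ultimately show ?thesis by (rule continuous_on_eq)
  qed
  have "closed ?A" "closed ?B" using compact_S by (simp_all add: closed_Times compact_imp_closed)
  then have con: "continuous_on (?A \<union> ?B) (\<lambda>p. slot (fst p) (snd p))"
    using piece[of n] piece[of "n - 1"] by (intro continuous_on_closed_Un) auto
  have AB: "?A \<union> ?B = {real_of_int n - 1..real_of_int n + 1} \<times> S" by (auto simp: not_le)
  have np: "of_int n - 1 < fst p" "fst p < of_int n + 1" unfolding n_def by linarith+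
  then have "p \<in> ?A \<union> ?B" using p unfolding AB by auto
  then have "continuous (at p within ?A \<union> ?B) (\<lambda>p. slot (fst p) (snd p))"
    using con by (simp add: continuous_on_eq_continuous_within)
  moreover have "at p within ?A \<union> ?B = at p within UNIV \<times> S"
    unfolding AB
    by (rule at_within_nhd[where S = "{of_int n - 1<..<of_int n + 1} \<times> UNIV"])
       (use np in \<open>auto intro!: open_Times simp: mem_Times_iff\<close>)
  ultimately show "continuous (at p within UNIV \<times> S) (\<lambda>p. slot (fst p) (snd p))" by simp
qed

definition turn :: "complex \<Rightarrow> real" where "turn w = Im w / (2 * pi)"

text \<open>The first coordinate is the point of the annulus; the other two determine the fibre
  point up to the deck action, see \<open>emb_eqD\<close>.\<close>

definition emb :: "complex \<times> real \<Rightarrow> complex \<times> real \<times> real" where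
  "emb p = (exp (fst p), slot (turn (fst p)) (snd p), slot (turn (fst p) + 1/2) (snd p))"

text \<open>The deck action behind the suspension: the angle makes \<open>n\<close> turns while the
  fibre moves by the power \<open>- n\<close>.\<close>

definition shift :: "int \<Rightarrow> complex \<times> real \<Rightarrow> complex \<times> real" where
  "shift n p = (fst p + of_int n * (2 * of_real pi * \<i>), T (- n) (snd p))"

lemma fst_emb: "fst (emb p) = exp (fst p)" by (simp add: emb_def)

lemma continuous_emb: "continuous_on (UNIV \<times> S) emb"
proof -
  have "continuous_on (UNIV \<times> S) (\<lambda>p. slot (turn (fst p) + a) (snd p))" for a
    unfolding turn_def
    by (rule continuous_on_compose2[OF continuous_slot, where f = "\<lambda>p. (Im (fst p) / (2 * pi) + a, snd p)", simplified])
       (auto intro!: continuous_intros)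
  from this[of 0] this[of "1/2"] show ?thesis
    unfolding emb_def by (intro continuous_intros) simp_all
qed

lemma turn_shift: "turn (w + of_int n * (2 * of_real pi * \<i>)) = turn w + of_int n"
  by (simp add: turn_def field_simps)

lemma emb_shift:
  assumes "snd p \<in> S"
  shows "emb (shift n p) = emb p"
proof -
  have "exp (fst p + of_int n * (2 * of_real pi * \<i>)) = exp (fst p)"
    by (subst exp_eq) (auto intro!: exI[of _ n] simp: mult_ac)
  moreover have "turn (fst p) + of_int n + 1/2 = (turn (fst p) + 1/2) + of_int n" by simp
  ultimately show ?thesis
    unfolding emb_def shift_def fst_conv snd_conv turn_shift using slot_shift[OF assms] by metis
qed

text \<open>Equal first coordinates fix the number \<open>n\<close> of turns. After turning
  \<open>q\<close> back, both points lie over the same \<open>w\<close>, and whichever slot has a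
  nonzero sine there determines the fibre point, each \<open>T m\<close> being injective.\<close>

lemma emb_eqD:
  assumes "emb p = emb q" "snd p \<in> S" "snd q \<in> S"
  obtains n where "q = shift n p"
proof -
  have e: "exp (fst p) = exp (fst q)" using assms(1) by (simp add: emb_def)
  then obtain n :: int where "fst q = fst p + of_int (2 * n) * pi * \<i>" by (metis exp_eq)
  then have n: "fst q = fst p + of_int n * (2 * of_real pi * \<i>)" by simp
  define y where "y = T n (snd q)"
  have y: "y \<in> S" "snd q = T (- n) y" using assms(3) T_in T_inverse by (auto simp: y_def)
  have "emb q = emb (shift n (fst p, y))" by (simp add: emb_def shift_def n y(2))
  then have "emb p = emb (fst p, y)" using assms(1) emb_shift[of "(fst p, y)" n] y(1) by simp
  then have eq: "slot (turn (fst p)) (snd p) = slot (turn (fst p)) y"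
    "slot (turn (fst p) + 1/2) (snd p) = slot (turn (fst p) + 1/2) y" by (auto simp: emb_def)
  have inj: "snd p = y" if "T m (snd p) = T m y" for m
    by (metis that T_inverse(1)[OF assms(2)] T_inverse(1)[OF y(1)])
  have "sin (pi * turn (fst p)) \<noteq> 0 \<or> sin (pi * (turn (fst p) + 1/2)) \<noteq> 0"
  proof -
    have "sin (pi * (turn (fst p) + 1/2)) = cos (pi * turn (fst p))"
      by (simp add: distrib_left sin_add)
    then show ?thesis using sin_zero_abs_cos_one[of "pi * turn (fst p)"] by auto
  qed
  then have "snd p = y" using eq inj unfolding slot_def by auto
  then have "q = shift n p" using n y by (simp add: shift_def prod_eq_iff)
  then show ?thesis by (rule that)
qed

end

locale suspension = essential_cofrontier \<Psi> U V + minimal_flow S T for \<Psi> U V S T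
begin

abbreviation cyl :: "(complex \<times> real) set" where "cyl \<equiv> lift \<times> S"
abbreviation M :: "(complex \<times> real \<times> real) set" where "M \<equiv> emb ` cyl"

lemma closed_cyl: "closed cyl"
  by (intro closed_Times closed_lift compact_imp_closed compact_S)

lemma continuous_emb_cyl: "continuous_on cyl emb"
  by (rule continuous_on_subset[OF continuous_emb]) auto

lemma shift_in_cyl: "p \<in> cyl \<Longrightarrow> shift n p \<in> cyl"
  using lift_shift[of "fst p" n] T_in by (auto simp: shift_def)

lemma closed_preimage: "closed A \<Longrightarrow> closed {p \<in> cyl. emb p \<in> A}"
  using continuous_closed_preimage[OF continuous_emb_cyl closed_cyl, of A]
  by (simp add: Int_def vimage_def)

text \<open>Compact fundamental domain, one full turn of the closed strip.\<close>

definition period :: "(complex \<times> real) set" where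
  "period = cbox 0 (Complex (ln 2) (2 * pi)) \<times> S"

lemma compact_period: "compact period"
  unfolding period_def by (intro compact_Times compact_cbox compact_S)

lemma shift_to_period:
  assumes "p \<in> cyl"
  obtains n where "shift n p \<in> period"
proof
  define n where "n = - \<lfloor>turn (fst p)\<rfloor>"
  have w: "fst (shift n p) \<in> lift" using shift_in_cyl[OF assms] by (metis mem_Times_iff)
  then have "0 < Re (fst (shift n p))" "Re (fst (shift n p)) < ln 2" using lift_strip by auto
  moreover have "turn (fst (shift n p)) = turn (fst p) + of_int n"
    by (simp add: shift_def turn_shift del: of_int_mult)
  then have "0 \<le> turn (fst (shift n p))" "turn (fst (shift n p)) \<le> 1"
    unfolding n_def by linarith+
  then have "0 \<le> Im (fst (shift n p))" "Im (fst (shift n p)) \<le> 2 * pi"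
    using pi_gt_zero unfolding turn_def by (auto simp: zero_le_divide_iff divide_le_eq simp del: pi_gt_zero)
  moreover have "snd (shift n p) \<in> S" using shift_in_cyl[OF assms] by (metis mem_Times_iff)
  ultimately show "shift n p \<in> period"
    by (auto simp: period_def mem_Times_iff in_cbox_complex_iff)
qed

text \<open>\<open>A\<close> itself may be unbounded, but by saturation its part in the compact
  \<open>period\<close> already produces the whole image.\<close>

lemma compact_image_saturated:
  assumes "closed A" "A \<subseteq> cyl" and sat: "\<And>p n. p \<in> A \<Longrightarrow> shift n p \<in> A"
  shows "compact (emb ` A)"
proof -
  have "emb ` A = emb ` (A \<inter> period)"
  proof (intro subset_antisym subsetI)
    fix y assume "y \<in> emb ` A"
    then obtain p where p: "p \<in> A" "y = emb p" by blast
    then obtain n where "shift n p \<in> period" using shift_to_period assms(2) by blast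
    moreover have "y = emb (shift n p)" using p assms(2) emb_shift[of p n] by auto
    ultimately show "y \<in> emb ` (A \<inter> period)" using sat[OF p(1)] by blast
  qed auto
  moreover have "compact (emb ` (A \<inter> period))"
  proof (rule compact_continuous_image)
    show "continuous_on (A \<inter> period) emb"
      using continuous_emb_cyl by (rule continuous_on_subset) (use assms(2) in auto)
    show "compact (A \<inter> period)" using assms(1) compact_period by (simp add: closed_Int_compact)
  qed
  ultimately show ?thesis by simp
qed

lemma compact_M: "compact M"
  using closed_cyl shift_in_cyl by (intro compact_image_saturated) auto

lemma M_nonempty: "M \<noteq> {}"
  using lift_nonempty S_nonempty by auto

text \<open>The fibre points whose whole leaf is mapped into \<open>K\<close> form a closed set. It
  is invariant, since the leaves through \<open>x\<close> and \<open>T n x\<close> have the same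
  image, so minimality applies.\<close>

lemma leaf_dense:
  assumes K: "closed K" and c: "c \<in> S" and leaf: "\<And>w. w \<in> lift \<Longrightarrow> emb (w, c) \<in> K"
  shows "M \<subseteq> K"
proof -
  define L where "L = {x \<in> S. \<forall>w\<in>lift. emb (w, x) \<in> K}"
  have "closed {x \<in> S. emb (w, x) \<in> K}" for w
  proof -
    have "continuous_on S (\<lambda>x. emb (w, x))"
      by (rule continuous_on_compose2[OF continuous_emb, of S "\<lambda>x. (w, x)"]) (auto intro!: continuous_intros)
    from continuous_closed_preimage[OF this compact_imp_closed[OF compact_S] K]
    show ?thesis by (simp add: Int_def vimage_def)
  qed
  moreover have "L = (\<Inter>w\<in>lift. {x \<in> S. emb (w, x) \<in> K})"
    using lift_nonempty by (auto simp: L_def)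
  ultimately have "closed L" by (simp add: closed_INT)
  moreover have TL: "T n x \<in> L" if "x \<in> L" for n x
  proof -
    have x: "x \<in> S" "\<And>w. w \<in> lift \<Longrightarrow> emb (w, x) \<in> K" using that by (auto simp: L_def)
    have "emb (w, T n x) \<in> K" if w: "w \<in> lift" for w
    proof -
      have "emb (shift n (w, T n x)) = emb (w, T n x)" using T_in[OF x(1)] by (simp add: emb_shift)
      moreover have "shift n (w, T n x) = (w + of_int n * (2 * of_real pi * \<i>), x)"
        using T_inverse(1)[OF x(1)] by (simp add: shift_def)
      ultimately show ?thesis using x(2) w lift_shift[of w n] by metis
    qed
    then show ?thesis using T_in[OF x(1)] by (simp add: L_def)
  qed
  moreover have "T 1 ` L = L"
  proof
    show "L \<subseteq> T 1 ` L"
    proof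
      fix x assume x: "x \<in> L"
      then have "T 1 (T (- 1) x) = x" using T_inverse(2)[of x 1] by (simp add: L_def)
      then show "x \<in> T 1 ` L" using TL[OF x, of "- 1"] by (metis imageI)
    qed
  qed (use TL in auto)
  moreover have "L \<noteq> {}" "L \<subseteq> S" using c leaf by (auto simp: L_def)
  ultimately have "L = S" by (intro minimal_T)
  then show ?thesis unfolding L_def by blast
qed

lemma connected_M: "connected M"
proof -
  obtain c where c: "c \<in> S" using S_nonempty by blast
  have "continuous_on lift (\<lambda>w. emb (w, c))"
    by (rule continuous_on_compose2[OF continuous_emb, of lift "\<lambda>w. (w, c)"])
       (use c in \<open>auto intro!: continuous_intros\<close>)
  then have con: "connected ((\<lambda>w. emb (w, c)) ` lift)"
    by (rule connected_continuous_image[OF _ connected_lift])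
  have "M \<subseteq> closure ((\<lambda>w. emb (w, c)) ` lift)"
    by (rule leaf_dense[OF closed_closure c]) (metis closure_subset imageI subsetD)
  moreover have "(\<lambda>w. emb (w, c)) ` lift \<subseteq> M" using c by auto
  ultimately show ?thesis using connected_intermediate_closure[OF con] by blast
qed

text \<open>\<open>\<sigma>\<close> tells at which end \<open>Z\<close> is unbounded. Translates of
  \<open>Z\<close> against this direction still reach arbitrarily far that way, while the fixed
  point \<open>z0\<close> is eventually carried past the other end of any compact path. Their fibre
  points subconverge to \<open>c'\<close>.\<close>

lemma long_plaque:
  assumes A: "closed A" "A \<subseteq> cyl" "\<And>p n. p \<in> A \<Longrightarrow> shift n p \<in> A"
    and Z: "connected Z" "Z \<times> {c} \<subseteq> A" "z0 \<in> Z"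
    and \<sigma>: "\<sigma> = 1 \<or> \<sigma> = - 1" and far: "\<And>B. \<exists>z\<in>Z. B < of_int \<sigma> * Im z"
  obtains c' where "c' \<in> S" "lift \<times> {c'} \<subseteq> A"
proof -
  have Zl: "Z \<subseteq> lift" and c: "c \<in> S" using Z(2,3) A(2) by blast+
  define a where "a k = of_int (- \<sigma> * int k) * (2 * of_real pi * \<i>)" for k
  define Zk where "Zk k = (\<lambda>z. z + a k) ` Z" for k
  have ZkA: "(z, T (\<sigma> * int k) c) \<in> A" if z: "z \<in> Zk k" for z k
  proof -
    obtain u where u: "u \<in> Z" "z = u + a k" using z by (auto simp: Zk_def)
    then have "shift (- \<sigma> * int k) (u, c) \<in> A" using A(3) Z(2) by blast
    then show ?thesis by (simp add: shift_def u a_def)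
  qed
  have Ima: "of_int \<sigma> * Im (z + a k) = of_int \<sigma> * Im z - 2 * pi * k" for z k
    using \<sigma> by (auto simp: a_def)
  have "\<forall>k. T (\<sigma> * int k) c \<in> S" using T_in c by blast
  then obtain c' r where r: "c' \<in> S" "strict_mono r" "((\<lambda>k. T (\<sigma> * int k) c) \<circ> r) \<longlonglongrightarrow> c'"
    using compact_S unfolding compact_def by meson
  have "lift \<times> {c'} \<subseteq> A"
  proof (rule ccontr)
    assume "\<not> lift \<times> {c'} \<subseteq> A"
    then obtain w where w: "w \<in> lift" "(w, c') \<notin> A" by blast
    \<comment> \<open>Slice of \<open>A\<close> over the limit fibre point; the missing point
      \<open>w\<close> opens the gap through which \<open>P\<close> passes.\<close>
    define K where "K = {w. (w, c') \<in> A}"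
    have "K = (\<lambda>w. (w, c')) -` A" by (auto simp: K_def)
    then have "closed K" using A(1) by (auto intro!: closed_vimage continuous_intros)
    then obtain P where P: "path P" "Re (pathstart P) \<le> 0" "ln 2 \<le> Re (pathfinish P)"
      "path_image P \<inter> K = {}"
      using path_through_gap[of K w] w A(2) unfolding K_def by blast
    have compP: "compact (path_image P)" using P(1) by (rule compact_path_image)
    then obtain B where B: "\<And>p. p \<in> path_image P \<Longrightarrow> norm p \<le> B"
      using compact_imp_bounded[OF compP] unfolding bounded_iff by blast
    have ImB: "- B \<le> of_int \<sigma> * Im p" "of_int \<sigma> * Im p \<le> B" if "p \<in> path_image P" for p
      using B[OF that] abs_Im_le_cmod[of p] \<sigma> by (auto simp: abs_le_iff)
    \<comment> \<open>From index \<open>k0\<close> on, the translate of \<open>z0\<close> lies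
      beyond \<open>P\<close>, on the side opposite to the unbounded end.\<close>
    obtain k0 :: nat where k0: "of_int \<sigma> * Im z0 + B < 2 * pi * k0"
      using reals_Archimedean3[of "2 * pi"] by (auto simp: mult.commute)
    have "\<exists>p\<in>path_image P. (p, T (\<sigma> * int (r (k + k0))) c) \<in> A" for k
    proof -
      let ?m = "r (k + k0)"
      have "k0 \<le> ?m" using seq_suble[OF r(2), of "k + k0"] by simp
      then have "2 * pi * k0 \<le> 2 * pi * ?m" by simp
      then have lo: "of_int \<sigma> * Im (z0 + a ?m) < - B" using k0 unfolding Ima by linarith
      obtain z1 where z1: "z1 \<in> Z" "B + 2 * pi * ?m < of_int \<sigma> * Im z1" using far by blast
      then have hi: "B < of_int \<sigma> * Im (z1 + a ?m)" unfolding Ima by linarith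
      have in_Zk: "z0 + a ?m \<in> Zk ?m" "z1 + a ?m \<in> Zk ?m" using Z(3) z1(1) by (auto simp: Zk_def)
      have conZk: "connected (Zk ?m)"
        unfolding Zk_def by (intro connected_continuous_image[OF _ Z(1)] continuous_intros)
      have "Zk ?m \<subseteq> lift" using ZkA A(2) by blast
      then have strip: "Zk ?m \<subseteq> {z. 0 < Re z \<and> Re z < ln 2}" using lift_strip by blast
      have "Zk ?m \<inter> path_image P \<noteq> {}"
      proof (cases "\<sigma> = 1")
        case True
        show ?thesis
        proof (rule crosses_strip[OF conZk strip P(1-3) in_Zk(1) _ in_Zk(2)])
          fix p assume "p \<in> path_image P"
          from ImB[OF this] lo hi True
          show "Im (z0 + a ?m) < Im p" "Im p < Im (z1 + a ?m)" by auto
        qed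
      next
        case False
        \<comment> \<open>Up and down are exchanged here, hence also the parts of \<open>z0\<close>
          and \<open>z1\<close>.\<close>
        then have "\<sigma> = - 1" using \<sigma> by simp
        show ?thesis
        proof (rule crosses_strip[OF conZk strip P(1-3) in_Zk(2) _ in_Zk(1)])
          fix p assume "p \<in> path_image P"
          from ImB[OF this] lo hi \<open>\<sigma> = - 1\<close>
          show "Im (z1 + a ?m) < Im p" "Im p < Im (z0 + a ?m)" by auto
        qed
      qed
      then show ?thesis using ZkA by blast
    qed
    \<comment> \<open>The crossing points stay on the compact path, so they subconverge to some
      \<open>p\<close> on \<open>P\<close>; closedness puts \<open>(p, c')\<close> into
      \<open>A\<close>, against the choice of \<open>P\<close>.\<close>
    then obtain f where f: "\<And>k. f k \<in> path_image P" "\<And>k. (f k, T (\<sigma> * int (r (k + k0))) c) \<in> A"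
      by metis
    then obtain p s where s: "p \<in> path_image P" "strict_mono s" "(f \<circ> s) \<longlonglongrightarrow> p"
      using compP unfolding compact_def by metis
    have "(\<lambda>k. T (\<sigma> * int (r (k + k0))) c) \<longlonglongrightarrow> c'"
      using LIMSEQ_ignore_initial_segment[OF r(3), of k0] by (simp add: o_def)
    from LIMSEQ_subseq_LIMSEQ[OF this s(2)]
    have "(\<lambda>k. (f (s k), T (\<sigma> * int (r (s k + k0))) c)) \<longlonglongrightarrow> (p, c')"
      using s(3) by (intro tendsto_Pair) (auto simp: o_def)
    then have "(p, c') \<in> A" using A(1) f(2) by (meson closed_sequentially)
    then show False using P(4) s(1) by (auto simp: K_def)
  qed
  then show ?thesis using that r(1) by blast
qed

text \<open>A compact component \<open>Z'\<close> has small compact clopen neighbourhoods in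
  \<open>A\<close>. The saturation of such a neighbourhood and its complement split \<open>K\<close>
  into two disjoint closed parts, so connectedness of \<open>K\<close> leaves only the image of the
  neighbourhood.\<close>

lemma subcontinuum_cases:
  assumes K: "K \<subseteq> M" "compact K" "connected K" "K \<noteq> {}"
  obtains "K = M" | Z c where "c \<in> S" "Z \<subseteq> lift" "compact Z" "connected Z" "K = emb ` (Z \<times> {c})"
proof -
  define A where "A = {p \<in> cyl. emb p \<in> K}"
  have clA: "closed A" unfolding A_def using K(2) by (intro closed_preimage compact_imp_closed)
  have Asub: "A \<subseteq> cyl" by (auto simp: A_def)
  have sat: "shift n p \<in> A" if "p \<in> A" for n p
    using that shift_in_cyl[of p n] emb_shift[of p n] by (auto simp: A_def)
  have im: "emb ` A = K" using K(1) by (auto simp: A_def)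
  obtain p0 where p0: "p0 \<in> A" using K(4) im by blast
  define c where "c = snd p0"
  define Z' where "Z' = connected_component_set A p0"
  define Z where "Z = fst ` Z'"
  have Z'A: "Z' \<subseteq> A" and conZ': "connected Z'" and p0Z': "p0 \<in> Z'"
    using p0 by (auto simp: Z'_def connected_component_subset)
  have clZ': "closed Z'" unfolding Z'_def by (rule closed_connected_component[OF clA])
  have cS: "c \<in> S" using p0 by (auto simp: A_def c_def)
  \<comment> \<open>The fibre coordinate is constant on a connected set because \<open>S\<close> is
    totally disconnected.\<close>
  have snd_c: "snd q = c" if "q \<in> Z'" for q
  proof -
    have "connected (snd ` Z')" by (intro connected_continuous_image conZ' continuous_intros)
    moreover have "snd ` Z' \<subseteq> S" using Z'A by (auto simp: A_def)
    ultimately show ?thesis using that p0Z' unfolding c_def by (intro totally_disconnected_S) auto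
  qed
  have Z': "Z' = Z \<times> {c}" unfolding Z_def using snd_c by force
  have conZ: "connected Z" unfolding Z_def by (intro connected_continuous_image conZ' continuous_intros)
  have Zl: "Z \<subseteq> lift" using Z'A unfolding Z' A_def by auto
  show thesis
  proof (cases "compact Z'")
    case True
    then have "compact Z" unfolding Z_def by (intro compact_continuous_image continuous_intros)
    have "K \<subseteq> emb ` Z'"
    proof
      fix k assume k: "k \<in> K"
      show "k \<in> emb ` Z'"
      proof (rule ccontr)
        assume kn: "k \<notin> emb ` Z'"
        define O' where "O' = - {p \<in> cyl. emb p \<in> {k}}"
        have "open O'" unfolding O'_def open_Compl by (intro open_Compl closed_preimage) simp
        moreover have "Z' \<subseteq> O'" using kn by (auto simp: O'_def)
        moreover have "Z' \<in> components A" unfolding Z'_def using p0 by (rule componentsI)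
        ultimately obtain W where W: "openin (top_of_set A) W" "compact W" "Z' \<subseteq> W" "W \<subseteq> O'"
          using Sura_Bura_clopen_subset[of A Z' O'] closed_imp_locally_compact[OF clA] True by blast
        have WA: "W \<subseteq> A" using W(1) openin_imp_subset by blast
        \<comment> \<open>Saturation of \<open>W\<close>: relatively open in \<open>A\<close>, and
          with the same image as the compact \<open>W\<close>.\<close>
        define H where "H = (\<Union>n. A \<inter> shift n -` W)"
        have "openin (top_of_set A) (A \<inter> shift n -` W)" for n
        proof (rule continuous_openin_preimage[OF _ _ W(1)])
          show "continuous_on A (shift n)"
            unfolding shift_def using Asub
            by (intro continuous_intros continuous_on_compose2[OF continuous_T]) auto
          show "shift n \<in> A \<rightarrow> A" using sat by blast
        qed
        then have "openin (top_of_set A) H" unfolding H_def by (intro openin_Union) auto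
        then have "closed (A - H)"
          using clA by (metis closedin_closed_trans closedin_diff closedin_topspace topspace_euclidean_subtopology)
        have Wim: "emb ` H = emb ` W"
        proof (intro subset_antisym subsetI)
          fix y assume "y \<in> emb ` H"
          then obtain p n where pn: "p \<in> A" "shift n p \<in> W" "y = emb p" unfolding H_def by blast
          then have "emb (shift n p) = y" using emb_shift[of p n] Asub by auto
          then show "y \<in> emb ` W" using pn(2) by blast
        next
          fix y assume "y \<in> emb ` W"
          then obtain p where p: "p \<in> W" "y = emb p" by blast
          have "shift 0 p = p" using p(1) WA Asub T_0 by (force simp: shift_def prod_eq_iff)
          then have "p \<in> H" using p(1) WA by (auto simp: H_def intro!: exI[of _ 0])
          then show "y \<in> emb ` H" using p(2) by blast
        qed
        have dis: "emb ` (A - H) \<inter> emb ` W = {}"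
        proof -
          have False if pq: "p \<in> A" "p \<notin> H" "q \<in> W" "emb p = emb q" for p q
          proof -
            have "snd p \<in> S" "snd q \<in> S" using pq WA Asub by (auto simp: mem_Times_iff)
            then obtain n where "q = shift n p" by (rule emb_eqD[OF pq(4)])
            then show False using pq unfolding H_def by blast
          qed
          then show ?thesis by blast
        qed
        have satH: "shift n p \<in> A - H" if p: "p \<in> A - H" for p n
        proof -
          have "shift n p \<notin> H"
          proof
            assume "shift n p \<in> H"
            then have "emb (shift n p) \<in> emb ` W" using Wim by blast
            moreover have "emb (shift n p) = emb p" using p Asub by (intro emb_shift) auto
            ultimately show False using dis p by (metis IntI empty_iff imageI)
          qed
          then show ?thesis using sat p by blast
        qed
        \<comment> \<open>\<open>A - H\<close> is closed and saturated, so its image is compact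
          although the set itself may be unbounded.\<close>
        have "compact (emb ` (A - H))"
          using \<open>closed (A - H)\<close> Asub satH by (intro compact_image_saturated) auto
        then have clAH: "closed (emb ` (A - H))" by (rule compact_imp_closed)
        have "W \<subseteq> cyl" using WA Asub by (rule order_trans)
        then have "compact (emb ` W)"
          using W(2) continuous_on_subset[OF continuous_emb_cyl] by (intro compact_continuous_image)
        then have clW: "closed (emb ` W)" by (rule compact_imp_closed)
        have cov: "K \<subseteq> emb ` (A - H) \<union> emb ` W" using im Wim by blast
        have "emb ` W \<inter> K \<noteq> {}" using p0Z' W(3) im p0 by blast
        moreover have "emb ` (A - H) \<inter> emb ` W \<inter> K = {}" using dis by simp
        ultimately have "emb ` (A - H) \<inter> K = {}"
          using connected_closedD[OF K(3) _ cov clAH clW] by simp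
        then have "k \<in> emb ` W" using k cov by blast
        then show False using W(4) WA Asub by (auto simp: O'_def)
      qed
    qed
    then have "K = emb ` (Z \<times> {c})" using Z'A im Z' by blast
    then show thesis using that(2) cS Zl \<open>compact Z\<close> conZ by blast
  next
    case False
    then have "\<not> bounded Z'" using clZ' by (simp add: compact_eq_bounded_closed)
    then have unb: "\<not> bounded Z" unfolding Z' using bounded_Times[of Z "{c}"] by auto
    \<comment> \<open>The strip bounds the real parts, so the imaginary parts of \<open>Z\<close>
      are unbounded above or below.\<close>
    have "\<exists>\<sigma>::int. (\<sigma> = 1 \<or> \<sigma> = - 1) \<and> (\<forall>B. \<exists>z\<in>Z. B < of_int \<sigma> * Im z)"
    proof (rule ccontr)
      assume neg: "\<not> ?thesis"
      have bdd: "\<exists>B. \<forall>z\<in>Z. of_int \<sigma> * Im z \<le> B" if "\<sigma> = 1 \<or> \<sigma> = - 1" for \<sigma> :: int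
        using neg that by (metis not_le)
      obtain B1 B2 where B: "\<forall>z\<in>Z. Im z \<le> B1" "\<forall>z\<in>Z. - Im z \<le> B2"
        using bdd[of 1] bdd[of "- 1"] by auto
      have "Z \<subseteq> cbox (Complex 0 (- B2)) (Complex (ln 2) B1)"
      proof
        fix z assume z: "z \<in> Z"
        then have "0 < Re z \<and> Re z < ln 2" using Zl lift_strip by blast
        moreover have "Im z \<le> B1" "- Im z \<le> B2" using B z by blast+
        ultimately show "z \<in> cbox (Complex 0 (- B2)) (Complex (ln 2) B1)"
          by (simp add: in_cbox_complex_iff)
      qed
      then show False using unb bounded_cbox bounded_subset by blast
    qed
    then obtain \<sigma> :: int where \<sigma>: "\<sigma> = 1 \<or> \<sigma> = - 1" "\<And>B. \<exists>z\<in>Z. B < of_int \<sigma> * Im z" by blast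
    have "Z \<times> {c} \<subseteq> A" using Z' Z'A by blast
    moreover have "fst p0 \<in> Z" using p0Z' unfolding Z_def by (rule imageI)
    ultimately obtain c' where c': "c' \<in> S" "lift \<times> {c'} \<subseteq> A"
      using long_plaque[OF clA Asub sat conZ _ _ \<sigma>] by blast
    have "M \<subseteq> K"
    proof (rule leaf_dense[OF compact_imp_closed[OF K(2)] c'(1)])
      show "emb (w, c') \<in> K" if "w \<in> lift" for w using that c'(2) im by blast
    qed
    then show thesis using that(1) K(1) by blast
  qed
qed

end

section \<open>Hereditary indecomposability of the suspension\<close>

context suspension
begin

text \<open>The homeomorphism is the projection to the first coordinate, injective because
  \<open>exp\<close> is injective on \<open>Z\<close>, and continuous from a compact space to a
  Hausdorff one.\<close>

lemma plaque_homeomorphic: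
  assumes "c \<in> S" "Z \<subseteq> lift" "compact Z" "inj_on exp Z"
  shows "top_of_set (exp ` Z) homeomorphic_space top_of_set (emb ` (Z \<times> {c}))"
proof -
  have im: "fst ` emb ` (Z \<times> {c}) = exp ` Z" by (force simp: fst_emb)
  have "homeomorphic_map (top_of_set (emb ` (Z \<times> {c}))) (top_of_set (exp ` Z)) fst"
  proof (rule continuous_imp_homeomorphic_map)
    show "continuous_map (top_of_set (emb ` (Z \<times> {c}))) (top_of_set (exp ` Z)) fst"
      using im by (auto simp: continuous_map_in_subtopology intro: continuous_intros)
    have "compact (emb ` (Z \<times> {c}))"
      using assms by (intro compact_continuous_image continuous_on_subset[OF continuous_emb] compact_Times) auto
    then show "compact_space (top_of_set (emb ` (Z \<times> {c})))" by (simp add: compact_space_subtopology)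
    show "inj_on fst (topspace (top_of_set (emb ` (Z \<times> {c}))))"
      using assms(4) by (auto simp: inj_on_def fst_emb)
  qed (use im in \<open>auto simp: Hausdorff_space_subtopology\<close>)
  then show ?thesis
    using homeomorphic_map_imp_homeomorphic_space homeomorphic_space_sym by blast
qed

lemma proper_subcontinuum_plaque:
  assumes "K \<subseteq> M" "compact K" "connected K" "K \<noteq> {}" "K \<noteq> M"
  obtains Z c where "c \<in> S" "Z \<subseteq> lift" "compact Z" "connected Z" "K = emb ` (Z \<times> {c})"
proof (rule subcontinuum_cases[OF assms(1-4)])
  assume "K = M"
  then show thesis using assms(5) by contradiction
qed (rule that)

context
  assumes hered: "hereditarily_indecomposable (top_of_set \<Psi>)"
begin

lemma nested_subcontinua:
  assumes "compact A" "connected A" "compact B" "connected B" "A \<subseteq> \<Psi>" "B \<subseteq> \<Psi>" "A \<inter> B \<noteq> {}"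
  shows "A \<subseteq> B \<or> B \<subseteq> A"
proof -
  have "subcontinuum (top_of_set \<Psi>) A" "subcontinuum (top_of_set \<Psi>) B"
    unfolding subcontinuum_top_of_set using assms by auto
  then show ?thesis
    using hered assms(7) unfolding hereditarily_indecomposable_iff_nested by blast
qed

lemma exp_inj_on_plaque: "\<lbrakk>compact Z; connected Z; Z \<subseteq> lift\<rbrakk> \<Longrightarrow> inj_on exp Z"
  by (rule exp_inj_on_if_nested[OF nested_subcontinua]) auto

lemma pseudo_arc_proper_subcontinuum:
  assumes circ: "circularly_chainable (top_of_set \<Psi>)"
    and K: "K \<subseteq> M" "compact K" "connected K" "K \<noteq> {}" "K \<noteq> M" and ns: "\<nexists>x. K = {x}"
  shows "pseudo_arc (top_of_set K)"
proof -
  obtain Z c where Z: "c \<in> S" "Z \<subseteq> lift" "compact Z" "connected Z" "K = emb ` (Z \<times> {c})"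
    by (rule proper_subcontinuum_plaque[OF K])
  have inj: "inj_on exp Z" using exp_inj_on_plaque Z by blast
  define Q where "Q = exp ` Z"
  have hom: "top_of_set Q homeomorphic_space top_of_set K"
    unfolding Q_def Z(5) by (rule plaque_homeomorphic[OF Z(1-3) inj])
  have Q: "Q \<subseteq> \<Psi>" "Q \<noteq> \<Psi>" "compact Q" "connected Q" "Q \<noteq> {}"
    using Z K(4) exp_image_ne[OF Z(3) inj] unfolding Q_def
    by (auto intro!: compact_continuous_image connected_continuous_image continuous_intros)
  have sub: "subcontinuum (top_of_set \<Psi>) Q" unfolding subcontinuum_top_of_set using Q by auto
  have tQ: "subtopology (top_of_set \<Psi>) Q = top_of_set Q"
    using Q(1) by (simp add: subtopology_subtopology Int_absorb1)
  obtain z where "z \<in> Z" using K(4) unfolding Z(5) by blast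
  moreover have "Z \<noteq> {z}"
  proof
    assume "Z = {z}"
    then have "K = {emb (z, c)}" by (simp add: Z(5))
    then show False using ns by blast
  qed
  ultimately obtain z' where "z \<in> Z" "z' \<in> Z" "z \<noteq> z'" by blast
  then have two: "\<exists>x y. x \<in> Q \<and> y \<in> Q \<and> x \<noteq> y" using inj by (auto simp: Q_def inj_on_def)
  have "chainable (top_of_set Q)"
    using chainable_proper_subcontinuum[OF circ sub] Q(2)
    by (simp add: tQ metrizable_space_subtopology metrizable_space_euclidean)
  moreover have "hereditarily_indecomposable (top_of_set Q)"
    using hereditarily_indecomposable_subcontinuum[OF hered sub] by (simp add: tQ)
  ultimately have "pseudo_arc (top_of_set Q)"
    using two Q by (simp add: pseudo_arc_def continuum_space_top_of_set)
  then show ?thesis using homeomorphic_pseudo_arc hom by blast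
qed

text \<open>If neither subcontinuum is \<open>M\<close>, both are images of compact plaques. A deck
  translation moves the first plaque into the slice of the second so that they share the point
  \<open>z\<close>; their images in \<Psi> are nested, and unique lifting returns this to the
  plaques.\<close>

lemma hereditarily_indecomposable_suspension: "hereditarily_indecomposable (top_of_set M)"
  unfolding hereditarily_indecomposable_iff_nested
proof (intro conjI allI impI)
  show "continuum_space (top_of_set M)"
    unfolding continuum_space_top_of_set using M_nonempty compact_M connected_M by blast
next
  fix A B assume *: "subcontinuum (top_of_set M) A \<and> subcontinuum (top_of_set M) B \<and> A \<inter> B \<noteq> {}"
  then have A: "A \<subseteq> M" "compact A" "connected A" "A \<noteq> {}" and B: "B \<subseteq> M" "compact B" "connected B" "B \<noteq> {}"
    and ne: "A \<inter> B \<noteq> {}" unfolding subcontinuum_top_of_set by auto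
  show "A \<subseteq> B \<or> B \<subseteq> A"
  proof (cases "A = M \<or> B = M")
    case True then show ?thesis using A B by blast
  next
    case False
    obtain Y a where Y: "a \<in> S" "Y \<subseteq> lift" "compact Y" "connected Y" "A = emb ` (Y \<times> {a})"
      by (rule proper_subcontinuum_plaque[OF A]) (use False in blast)
    obtain Z b where Z: "b \<in> S" "Z \<subseteq> lift" "compact Z" "connected Z" "B = emb ` (Z \<times> {b})"
      by (rule proper_subcontinuum_plaque[OF B]) (use False in blast)
    obtain y z where yz: "y \<in> Y" "z \<in> Z" "emb (y, a) = emb (z, b)"
      using ne unfolding Y(5) Z(5) by blast
    then obtain n where n: "(z, b) = shift n (y, a)" using emb_eqD[of "(y, a)" "(z, b)"] Y(1) Z(1) by auto
    define X where "X = (\<lambda>w. w + of_int n * (2 * of_real pi * \<i>)) ` Y"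
    have X: "compact X" "connected X" "X \<subseteq> lift" "z \<in> X"
      using Y(2-4) yz(1) n lift_shift unfolding X_def
      by (auto simp: shift_def intro!: compact_continuous_image connected_continuous_image continuous_intros)
    have "X \<times> {b} = shift n ` (Y \<times> {a})"
      using n by (force simp: X_def shift_def)
    moreover have "emb ` shift n ` (Y \<times> {a}) = emb ` (Y \<times> {a})"
      unfolding image_image by (intro image_cong refl emb_shift) (use Y(1) in auto)
    ultimately have AX: "A = emb ` (X \<times> {b})" unfolding Y(5) by simp
    have "exp ` X \<subseteq> exp ` Z \<or> exp ` Z \<subseteq> exp ` X"
      using X Z yz(2)
      by (intro nested_subcontinua compact_continuous_image connected_continuous_image continuous_intros) auto
    then have "X \<subseteq> Z \<or> Z \<subseteq> X"
      using exp_lift_unique[of X Z z] exp_lift_unique[of Z X z] exp_inj_on_plaque X Z yz(2) by blast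
    then show ?thesis unfolding AX Z(5) by blast
  qed
qed

end

end

section \<open>The pseudo-suspension\<close>

context
  fixes X :: "'c topology" and h :: "'c \<Rightarrow> 'c"
  assumes h: "homeomorphic_map X X h"
begin

lemma
  assumes "x \<in> topspace X"
  shows hpow_Suc: "hpow X h (n + 1) x = h (hpow X h n x)"
    and hpow_in: "hpow X h n x \<in> topspace X"
proof -
  have surj: "h ` topspace X = topspace X" using h by (rule homeomorphic_imp_surjective_map)
  define k where "k = inv_into (topspace X) h"
  have k: "h (k y) = y" "k y \<in> topspace X" if "y \<in> topspace X" for y
    using that surj unfolding k_def by (metis f_inv_into_f, metis inv_into_into)
  have kin: "(k ^^ j) x \<in> topspace X" for j by (induction j) (use assms k in auto)
  have hin: "(h ^^ j) x \<in> topspace X" for j by (induction j) (use assms surj in auto)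
  show "hpow X h n x \<in> topspace X" using kin hin by (simp add: hpow_def k_def)
  show "hpow X h (n + 1) x = h (hpow X h n x)"
  proof (cases "0 \<le> n")
    case True
    then show ?thesis by (simp add: hpow_def nat_add_distrib)
  next
    case False
    then have e: "nat (- n) = Suc (nat (- (n + 1)))" by simp
    have "hpow X h n x = k ((k ^^ nat (- (n + 1))) x)"
      using False unfolding hpow_def e by (simp add: k_def)
    then have "h (hpow X h n x) = (k ^^ nat (- (n + 1))) x" using k(1)[OF kin] by simp
    also have "\<dots> = hpow X h (n + 1) x" using False by (auto simp: hpow_def k_def)
    finally show ?thesis by simp
  qed
qed

lemma hpow_add:
  assumes x: "x \<in> topspace X"
  shows "hpow X h (m + n) x = hpow X h m (hpow X h n x)"
proof (induction m rule: int_induct[where k = 0])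
  case base
  show ?case by (simp add: hpow_def)
next
  case (step1 m)
  then show ?case
    using hpow_Suc[OF x, of "m + n"] hpow_Suc[OF hpow_in[OF x], of m n] by (simp add: add_ac)
next
  case (step2 m)
  let ?y = "hpow X h n x"
  \<comment> \<open>The downward step is proved after applying \<open>h\<close> to both sides, which
    is then cancelled by injectivity.\<close>
  have "h (hpow X h (m - 1 + n) x) = hpow X h (m + n) x"
    using hpow_Suc[OF x, of "m - 1 + n"] by (simp add: algebra_simps)
  also have "\<dots> = h (hpow X h (m - 1) ?y)"
    using step2 hpow_Suc[OF hpow_in[OF x], of "m - 1" n] by simp
  finally show ?case
    using hpow_in[OF x] hpow_in[OF hpow_in[OF x]] homeomorphic_imp_injective_map[OF h]
    by (meson inj_onD)
qed

lemma continuous_map_hpow: "continuous_map X X (hpow X h n)"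
proof -
  have pow: "continuous_map X X (f ^^ j)" if "continuous_map X X f" for f :: "'c \<Rightarrow> 'c" and j
  proof (induction j)
    case (Suc j)
    then show ?case using continuous_map_compose[OF Suc that] by (simp add: comp_def)
  qed (simp add: id_def)
  obtain g where g: "homeomorphic_maps X X h g" using h homeomorphic_map_maps by blast
  have "continuous_map X X (inv_into (topspace X) h)"
  proof (rule continuous_map_eq)
    show "continuous_map X X g" using g by (simp add: homeomorphic_maps_def)
    fix y assume "y \<in> topspace X"
    moreover from this have "g y \<in> topspace X" "h (g y) = y"
      using g continuous_map_image_subset_topspace[of X X g] by (auto simp: homeomorphic_maps_def)
    ultimately show "g y = inv_into (topspace X) h y"
      using homeomorphic_imp_injective_map[OF h] by (metis inv_into_f_f)
  qed
  then show ?thesis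
    unfolding hpow_def using pow homeomorphic_imp_continuous_map[OF h] by simp
qed

end

text \<open>Conjugation with the homeomorphism \<open>f\<close>; a closed invariant part of the
  ternary set is pulled back to \<open>X\<close>, where minimality of \<open>h\<close>
  applies.\<close>

lemma minimal_flow_transported:
  assumes C: "homeomorphic_maps X (top_of_set cantor_ternary) f g" and h: "minimal_homeomorphism X h"
    and ne: "cantor_ternary \<noteq> {}"
  shows "minimal_flow cantor_ternary (\<lambda>n y. f (hpow X h n (g y)))"
proof
  have hom: "homeomorphic_map X X h" using h by (simp add: minimal_homeomorphism_def)
  have contf: "continuous_map X (top_of_set cantor_ternary) f"
    and contg: "continuous_map (top_of_set cantor_ternary) X g"
    and gf: "\<And>x. x \<in> topspace X \<Longrightarrow> g (f x) = x" and fg: "\<And>y. y \<in> cantor_ternary \<Longrightarrow> f (g y) = y"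
    using C by (auto simp: homeomorphic_maps_def)
  have gin: "g y \<in> topspace X" if "y \<in> cantor_ternary" for y
    using continuous_map_image_subset_topspace[OF contg] that by auto
  have fin: "f x \<in> cantor_ternary" if "x \<in> topspace X" for x
    using continuous_map_image_subset_topspace[OF contf] that by auto
  show "compact cantor_ternary" by (rule compact_cantor_ternary)
  show "cantor_ternary \<noteq> {}" by fact
  show "a = b" if "connected D" "D \<subseteq> cantor_ternary" "a \<in> D" "b \<in> D" for D a b
    using totally_disconnected_cantor_ternary that .
  show "f (hpow X h n (g x)) \<in> cantor_ternary" if "x \<in> cantor_ternary" for x n
    by (intro fin hpow_in[OF hom] gin that)
  have "continuous_map (top_of_set cantor_ternary) (top_of_set cantor_ternary) (f \<circ> hpow X h n \<circ> g)" for n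
    using contf contg continuous_map_hpow[OF hom] by (meson continuous_map_compose)
  then show "continuous_on cantor_ternary (\<lambda>y. f (hpow X h n (g y)))" for n
    by (auto simp: continuous_map_in_subtopology o_def)
  show "f (hpow X h 0 (g x)) = x" if "x \<in> cantor_ternary" for x
    using fg[OF that] by (simp add: hpow_def)
  show "f (hpow X h (m + n) (g x)) = f (hpow X h m (g (f (hpow X h n (g x)))))"
    if "x \<in> cantor_ternary" for x m n
    by (simp add: gf hpow_in[OF hom] gin that hpow_add[OF hom gin[OF that]])
  fix K assume K: "closed K" "K \<subseteq> cantor_ternary" "K \<noteq> {}" "(\<lambda>y. f (hpow X h 1 (g y))) ` K = K"
  define K' where "K' = {x \<in> topspace X. f x \<in> K}"
  have "closedin X K'"
    unfolding K'_def using K(1,2)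
    by (intro closedin_continuous_map_preimage[OF contf]) (auto intro: closed_subset)
  moreover have gK: "g ` K = K'"
    using K(2) gin fg gf unfolding K'_def by (force simp: image_iff subset_iff)
  moreover have "h ` K' = K'"
  proof -
    have "f ` h ` g ` K = K" using K(4) by (simp add: image_image hpow_def)
    then have "g ` f ` h ` K' = K'" by (simp add: gK)
    moreover have "h x \<in> topspace X" if "x \<in> K'" for x
      using that homeomorphic_imp_surjective_map[OF hom] by (auto simp: K'_def)
    then have "g ` f ` h ` K' = h ` K'" by (simp add: image_image gf)
    ultimately show ?thesis by simp
  qed
  ultimately have "K' = topspace X" using h K(3) unfolding minimal_homeomorphism_def by blast
  then show "K = cantor_ternary" using K(2) gin fg unfolding K'_def by (metis (mono_tags, lifting) mem_Collect_eq subsetI subset_antisym)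
qed

section \<open>Quotient topology and logarithmic polar coordinates\<close>

lemma
  shows openin_quotient_topology: "openin (quotient_topology P f) U \<longleftrightarrow> U \<subseteq> f ` topspace P \<and> openin P {x \<in> topspace P. f x \<in> U}"
    and topspace_quotient_topology: "topspace (quotient_topology P f) = f ` topspace P"
proof -
  show *: "openin (quotient_topology P f) U \<longleftrightarrow> U \<subseteq> f ` topspace P \<and> openin P {x \<in> topspace P. f x \<in> U}" for U
    unfolding quotient_topology_def topology_inverse'[OF istopology_quotient] ..
  have "{x \<in> topspace P. f x \<in> f ` topspace P} = topspace P" by auto
  then have "openin (quotient_topology P f) (f ` topspace P)" unfolding * by simp
  then show "topspace (quotient_topology P f) = f ` topspace P"
    using * by (metis openin_subset openin_topspace subset_antisym)
qed

lemma quotient_map_quotient_topology: "quotient_map P (quotient_topology P f) f"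
  unfolding quotient_map_def openin_quotient_topology topspace_quotient_topology by auto

text \<open>A point with radial coordinate s has modulus \<open>1 + s\<close> in the annulus, so its
  logarithm has real part \<open>ln (1 + s)\<close>; this lifts \<open>qcov\<close> through
  \<open>exp\<close>.\<close>

definition log_polar :: "real \<times> real \<Rightarrow> complex" where
  "log_polar p = Complex (ln (1 + fst p)) (2 * pi * snd p)"

lemma exp_log_polar: "0 \<le> fst p \<Longrightarrow> exp (log_polar p) = qcov p"
  by (simp add: log_polar_def qcov_def exp_eq_polar)

lemma log_polar_inverse: "0 \<le> Re w \<Longrightarrow> log_polar (exp (Re w) - 1, Im w / (2 * pi)) = w"
  by (simp add: log_polar_def complex_eq_iff)

text \<open>Matches deck translations of the logarithm with the part of \<open>ps_rel\<close> that
  concerns the strip.\<close>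

lemma log_polar_translate:
  assumes "0 \<le> fst p" "0 \<le> fst q"
  shows "log_polar q = log_polar p + of_int n * (2 * of_real pi * \<i>) \<longleftrightarrow>
         fst p = fst q \<and> snd q = snd p + of_int n"
proof -
  have "ln (1 + fst q) = ln (1 + fst p) \<longleftrightarrow> fst p = fst q" using assms by auto
  moreover have "2 * pi * snd q = 2 * pi * snd p + of_int n * (2 * pi) \<longleftrightarrow> snd q = snd p + of_int n"
  proof -
    have "2 * pi * snd p + of_int n * (2 * pi) = 2 * pi * (snd p + of_int n)" by (simp add: algebra_simps)
    then show ?thesis by simp
  qed
  ultimately show ?thesis by (simp add: log_polar_def complex_eq_iff)
qed

lemma continuous_qcov: "continuous_on A qcov"
  unfolding qcov_def by (intro continuous_intros)

text \<open>\<open>\<Theta>\<close> identifies exactly the points related by \<open>ps_rel\<close>,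
  so it descends to an injective map \<open>\<theta>\<close> on classes, continuous by the quotient
  property. From the compact pseudo-suspension into a Hausdorff space this is a homeomorphism onto
  \<open>M\<close>.\<close>

lemma pseudo_suspension_homeomorphic:
  assumes S: "suspension \<Psi> U V cantor_ternary (\<lambda>n y. f (hpow X h n (g y)))"
    and C: "homeomorphic_maps X (top_of_set cantor_ternary) f g" and hom: "homeomorphic_map X X h"
  shows "\<exists>\<theta>. homeomorphic_map (subtopology (ps_space X h) (pseudo_suspension X h \<Psi>))
     (top_of_set (minimal_flow.emb (\<lambda>n y. f (hpow X h n (g y))) ` (exp -` \<Psi> \<times> cantor_ternary))) \<theta>"
proof -
  interpret suspension \<Psi> U V cantor_ternary "\<lambda>n y. f (hpow X h n (g y))" by fact
  have contf: "continuous_map X (top_of_set cantor_ternary) f"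
    and contg: "continuous_map (top_of_set cantor_ternary) X g"
    and gf: "\<And>x. x \<in> topspace X \<Longrightarrow> g (f x) = x" and fg: "\<And>y. y \<in> cantor_ternary \<Longrightarrow> f (g y) = y"
    using C by (auto simp: homeomorphic_maps_def)
  have gin: "g y \<in> topspace X" if "y \<in> cantor_ternary" for y
    using continuous_map_image_subset_topspace[OF contg] that by auto
  have fin: "f x \<in> cantor_ternary" if "x \<in> topspace X" for x
    using continuous_map_image_subset_topspace[OF contf] that by auto
  define D where "D = topspace (ps_domain X)"
  have D: "a \<in> D \<longleftrightarrow> fst (fst a) \<in> {0..1} \<and> snd a \<in> topspace X" for a
    by (auto simp: D_def ps_domain_def mem_Times_iff)
  define \<Theta> where "\<Theta> a = emb (log_polar (fst a), f (snd a))" for a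
  have rel: "\<Theta> a = \<Theta> b \<longleftrightarrow> ps_rel X h a b" if "a \<in> D" "b \<in> D" for a b
  proof -
    have ab: "0 \<le> fst (fst a)" "0 \<le> fst (fst b)" "snd a \<in> topspace X" "snd b \<in> topspace X"
      using that by (auto simp: D)
    have "\<Theta> a = \<Theta> b \<longleftrightarrow> (\<exists>n. (log_polar (fst b), f (snd b)) = shift n (log_polar (fst a), f (snd a)))"
    proof
      assume "\<Theta> a = \<Theta> b"
      then show "\<exists>n. (log_polar (fst b), f (snd b)) = shift n (log_polar (fst a), f (snd a))"
        using emb_eqD[of "(log_polar (fst a), f (snd a))" "(log_polar (fst b), f (snd b))"] ab fin
        unfolding \<Theta>_def by (metis snd_conv)
    next
      assume "\<exists>n. (log_polar (fst b), f (snd b)) = shift n (log_polar (fst a), f (snd a))"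
      then show "\<Theta> a = \<Theta> b" unfolding \<Theta>_def using emb_shift ab fin by (metis snd_conv)
    qed
    also have "\<dots> \<longleftrightarrow> ps_rel X h a b"
    proof -
      have "f (snd b) = f (hpow X h (- n) (snd a)) \<longleftrightarrow> snd b = hpow X h (- n) (snd a)" for n
        using gf ab(3,4) hpow_in[OF hom ab(3)] by metis
      then show ?thesis
        unfolding ps_rel_def shift_def by (auto simp: log_polar_translate[OF ab(1,2)] gf[OF ab(3)])
    qed
    finally show ?thesis .
  qed
  have cls: "ps_class X h a = {b \<in> D. \<Theta> a = \<Theta> b}" if "a \<in> D" for a
    using rel[OF that] by (auto simp: ps_class_def D_def)
  \<comment> \<open>The chosen representative does not matter, as \<open>\<Theta>\<close> is
    constant on classes.\<close>
  define \<theta> where "\<theta> E = \<Theta> (SOME a. a \<in> E)" for E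
  have some: "(SOME b. b \<in> ps_class X h a) \<in> {b \<in> D. \<Theta> a = \<Theta> b}" if "a \<in> D" for a
  proof -
    have "a \<in> ps_class X h a" using cls[OF that] that by blast
    then have "(SOME b. b \<in> ps_class X h a) \<in> ps_class X h a" by (rule someI)
    then show ?thesis using cls[OF that] by blast
  qed
  have \<theta>: "\<theta> (ps_class X h a) = \<Theta> a" if "a \<in> D" for a
    using some[OF that] by (simp add: \<theta>_def)
  have fst\<Theta>: "fst (\<Theta> a) = qcov (fst a)" if "a \<in> D" for a
    using that by (simp add: \<Theta>_def fst_emb exp_log_polar D)
  have qC: "qC (ps_class X h a) = qcov (fst a)" if "a \<in> D" for a
  proof -
    let ?b = "SOME b. b \<in> ps_class X h a"
    have "?b \<in> D" "\<Theta> a = \<Theta> ?b" using some[OF that] by auto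
    then show ?thesis using fst\<Theta>[OF that] fst\<Theta>[of ?b] unfolding qC_def by simp
  qed
  have quot: "quotient_map (ps_domain X) (ps_space X h) (ps_class X h)"
    unfolding ps_space_def by (rule quotient_map_quotient_topology)
  have top: "topspace (ps_space X h) = ps_class X h ` D"
    unfolding ps_space_def D_def by (rule topspace_quotient_topology)
  have PS: "pseudo_suspension X h \<Psi> = ps_class X h ` {a \<in> D. qcov (fst a) \<in> \<Psi>}"
    unfolding pseudo_suspension_def top using qC by auto
  have "continuous_map (ps_domain X) (top_of_set (UNIV \<times> cantor_ternary)) (\<lambda>a. (log_polar (fst a), f (snd a)))"
  proof -
    have "continuous_on ({0..1} \<times> UNIV) log_polar"
      unfolding log_polar_def by (intro continuous_intros) auto
    then have "continuous_map (ps_domain X) euclidean (log_polar \<circ> fst)"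
      unfolding ps_domain_def
      by (intro continuous_map_compose[OF continuous_map_fst]) simp
    moreover have "continuous_map (ps_domain X) (top_of_set cantor_ternary) (f \<circ> snd)"
      unfolding ps_domain_def by (rule continuous_map_compose[OF continuous_map_snd contf])
    ultimately have "continuous_map (ps_domain X) (prod_topology (top_of_set UNIV) (top_of_set cantor_ternary))
        (\<lambda>a. (log_polar (fst a), f (snd a)))"
      unfolding o_def by (intro continuous_map_pairedI) simp_all
    then show ?thesis unfolding prod_topology_subtopology_eu .
  qed
  then have "continuous_map (ps_domain X) euclidean (emb \<circ> (\<lambda>a. (log_polar (fst a), f (snd a))))"
    using continuous_emb by (rule continuous_map_compose[OF _ continuous_map_iff_continuous[THEN iffD2]])
  then have "continuous_map (ps_domain X) euclidean (\<theta> \<circ> ps_class X h)"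
    by (rule continuous_map_eq) (use \<theta> in \<open>auto simp: \<Theta>_def D_def\<close>)
  then have cont\<theta>: "continuous_map (ps_space X h) euclidean \<theta>"
    by (rule continuous_compose_quotient_map[OF quot])
  have im: "\<theta> ` pseudo_suspension X h \<Psi> = M"
  proof
    show "\<theta> ` pseudo_suspension X h \<Psi> \<subseteq> M"
    proof
      fix y assume "y \<in> \<theta> ` pseudo_suspension X h \<Psi>"
      then obtain a where a: "a \<in> D" "qcov (fst a) \<in> \<Psi>" "y = \<Theta> a" unfolding PS using \<theta> by auto
      then have "(log_polar (fst a), f (snd a)) \<in> cyl"
        using fin by (simp add: D exp_log_polar)
      then show "y \<in> M" using a(3) by (simp add: \<Theta>_def)
    qed
    show "M \<subseteq> \<theta> ` pseudo_suspension X h \<Psi>"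
    proof
      fix y assume "y \<in> M"
      then obtain w x where wx: "w \<in> lift" "x \<in> cantor_ternary" "y = emb (w, x)" by blast
      then have "0 < Re w" "Re w < ln 2" using lift_strip by auto
      then have "exp (Re w) < 2" by (metis exp_less_cancel_iff exp_ln zero_less_numeral)
      define a where "a = ((exp (Re w) - 1, Im w / (2 * pi)), g x)"
      have lp: "log_polar (fst a) = w" using \<open>0 < Re w\<close> by (simp add: a_def log_polar_inverse)
      have aD: "a \<in> D" using \<open>0 < Re w\<close> \<open>exp (Re w) < 2\<close> gin[OF wx(2)] by (simp add: D a_def)
      have "qcov (fst a) \<in> \<Psi>" using exp_log_polar[of "fst a"] aD wx(1) lp by (simp add: D)
      moreover have "y = \<Theta> a" using wx(3) lp fg[OF wx(2)] by (simp add: \<Theta>_def a_def)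
      ultimately show "y \<in> \<theta> ` pseudo_suspension X h \<Psi>" unfolding PS using \<theta>[OF aD] aD by force
    qed
  qed
  have compX: "compact_space X"
    using C compact_cantor_ternary homeomorphic_compact_space[of X "top_of_set cantor_ternary"]
    by (metis compact_space_subtopology compactin_euclidean_iff homeomorphic_space_def)
  have compPS: "compactin (ps_space X h) (pseudo_suspension X h \<Psi>)"
  proof -
    \<comment> \<open>One period over \<Psi>: compact, and its product with the fibre meets every
      class over \<Psi>.\<close>
    define B where "B = {p \<in> {0..1} \<times> {0..1}. qcov p \<in> \<Psi>}"
    have "compact B"
    proof -
      have "B = ({0..1} \<times> {0..1}) \<inter> qcov -` \<Psi>" by (auto simp: B_def)
      then show ?thesis
        using continuous_on_closed_vimage[of UNIV qcov] continuous_qcov closed_\<Psi>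
        by (auto intro!: compact_Int_closed compact_Times closed_vimage)
    qed
    then have "compactin (top_of_set ({0..1} \<times> UNIV)) B"
      by (auto simp: compactin_subtopology B_def)
    then have "compactin (ps_domain X) (B \<times> topspace X)"
      using compX unfolding ps_domain_def by (simp add: compactin_Times compact_space_def)
    then have "compactin (ps_space X h) (ps_class X h ` (B \<times> topspace X))"
      using quotient_imp_continuous_map[OF quot] by (rule image_compactin)
    moreover have "ps_class X h ` (B \<times> topspace X) = pseudo_suspension X h \<Psi>"
    proof
      show "ps_class X h ` (B \<times> topspace X) \<subseteq> pseudo_suspension X h \<Psi>"
        unfolding PS by (rule image_mono) (auto simp: B_def D)
      show "pseudo_suspension X h \<Psi> \<subseteq> ps_class X h ` (B \<times> topspace X)"
      proof
        fix E assume "E \<in> pseudo_suspension X h \<Psi>"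
        then obtain a where a: "a \<in> D" "qcov (fst a) \<in> \<Psi>" "E = ps_class X h a" unfolding PS by blast
        \<comment> \<open>Brings the angular coordinate into [0, 1]; the fibre point moves by the
          opposite power to stay in the class.\<close>
        define n where "n = - \<lfloor>snd (fst a)\<rfloor>"
        define b where "b = ((fst (fst a), snd (fst a) + of_int n), hpow X h (- n) (snd a))"
        have bD: "b \<in> D" using a(1) hpow_in[OF hom] by (simp add: D b_def)
        have "ps_rel X h a b" by (auto simp: ps_rel_def b_def)
        then have eq: "\<Theta> a = \<Theta> b" using rel[OF a(1) bD] by simp
        then have "E = ps_class X h b" unfolding a(3) cls[OF a(1)] cls[OF bD] by simp
        moreover have "qcov (fst b) \<in> \<Psi>" using a(2) fst\<Theta>[OF a(1)] fst\<Theta>[OF bD] eq by simp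
        moreover have "0 \<le> snd (fst b)" "snd (fst b) \<le> 1" unfolding b_def n_def by simp_all linarith+
        ultimately show "E \<in> ps_class X h ` (B \<times> topspace X)"
          using bD by (intro image_eqI[of _ _ b]) (auto simp: B_def D mem_Times_iff)
      qed
    qed
    ultimately show ?thesis by simp
  qed
  have inj\<theta>: "inj_on \<theta> (pseudo_suspension X h \<Psi>)"
  proof (rule inj_onI)
    fix E E' assume "E \<in> pseudo_suspension X h \<Psi>" "E' \<in> pseudo_suspension X h \<Psi>"
      and eq: "\<theta> E = \<theta> E'"
    then obtain a b where ab: "a \<in> D" "b \<in> D" "E = ps_class X h a" "E' = ps_class X h b"
      unfolding PS by blast
    then have "\<Theta> a = \<Theta> b" using eq \<theta> by simp
    then show "E = E'" using ab cls by simp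
  qed
  have PSsub: "pseudo_suspension X h \<Psi> \<subseteq> topspace (ps_space X h)"
    by (auto simp: pseudo_suspension_def)
  then have topN: "topspace (subtopology (ps_space X h) (pseudo_suspension X h \<Psi>)) = pseudo_suspension X h \<Psi>"
    by auto
  have "homeomorphic_map (subtopology (ps_space X h) (pseudo_suspension X h \<Psi>)) (top_of_set M) \<theta>"
  proof (rule continuous_imp_homeomorphic_map)
    show "continuous_map (subtopology (ps_space X h) (pseudo_suspension X h \<Psi>)) (top_of_set M) \<theta>"
      using cont\<theta> im topN by (auto simp: continuous_map_in_subtopology continuous_map_from_subtopology)
    show "compact_space (subtopology (ps_space X h) (pseudo_suspension X h \<Psi>))"
      using compPS by (simp add: compact_space_subtopology)
    show "inj_on \<theta> (topspace (subtopology (ps_space X h) (pseudo_suspension X h \<Psi>)))"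
      using inj\<theta> by (simp only: topN)
  qed (use im topN in \<open>auto simp: Hausdorff_space_subtopology\<close>)
  then show ?thesis by blast
qed

theorem theorem3p6:
  fixes \<Psi> :: "complex set" and X :: "'c topology" and h :: "'c \<Rightarrow> 'c"
  assumes "cofrontier \<Psi>" and "essential \<Psi>"
    and "cantor_space X" and "minimal_homeomorphism X h"
  shows "continuum_space (subtopology (ps_space X h) (pseudo_suspension X h \<Psi>)) \<and>
         (pseudo_circle (top_of_set \<Psi>) \<longrightarrow>
           (\<forall>K. proper_subcontinuum (subtopology (ps_space X h) (pseudo_suspension X h \<Psi>)) K
                \<longrightarrow> pseudo_arc (subtopology (ps_space X h) K))
           \<and> hereditarily_indecomposable (subtopology (ps_space X h) (pseudo_suspension X h \<Psi>)))"
proof -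
  obtain U V where UV: "open U" "open V" "connected U" "connected V" "U \<inter> V = {}" "U \<union> V = - \<Psi>"
    "frontier U = \<Psi>" "frontier V = \<Psi>" "cball 0 1 \<subseteq> U" "- ball 0 2 \<subseteq> V"
    using essential_cofrontier_sides[OF assms(1,2)] by metis
  have ess: "essential_cofrontier \<Psi> U V"
    by unfold_locales (use UV assms(1) in \<open>auto simp: cofrontier_def\<close>)
  obtain f g where C: "homeomorphic_maps X (top_of_set cantor_ternary) f g"
    using assms(3) by (auto simp: cantor_space_def homeomorphic_space_def)
  have "(0::real) \<in> cantor_ternary"
    unfolding cantor_ternary_def by (auto intro!: exI[of _ "\<lambda>_. 0"])
  then have flow: "minimal_flow cantor_ternary (\<lambda>n y. f (hpow X h n (g y)))"
    using minimal_flow_transported[OF C assms(4)] by blast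
  interpret suspension \<Psi> U V cantor_ternary "\<lambda>n y. f (hpow X h n (g y))"
    using ess flow by (rule suspension.intro)
  define N where "N = subtopology (ps_space X h) (pseudo_suspension X h \<Psi>)"
  have "homeomorphic_map X X h" using assms(4) by (simp add: minimal_homeomorphism_def)
  from pseudo_suspension_homeomorphic[OF suspension_axioms C this]
  obtain \<theta> where \<theta>: "homeomorphic_map N (top_of_set M) \<theta>" unfolding N_def by blast
  then have NM: "N homeomorphic_space top_of_set M" by (rule homeomorphic_map_imp_homeomorphic_space)
  have cont: "continuum_space N"
    unfolding homeomorphic_continuum_space[OF NM] continuum_space_top_of_set
    using M_nonempty compact_M connected_M by blast
  moreover have "pseudo_arc (subtopology (ps_space X h) K)"
    if circle: "pseudo_circle (top_of_set \<Psi>)" and K: "proper_subcontinuum N K" for K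
  proof -
    have KN: "K \<subseteq> topspace N" and sub: "subcontinuum N K" and neN: "K \<noteq> topspace N"
      and ns: "\<nexists>x. K = {x}"
      using K by (auto simp: proper_subcontinuum_def subcontinuum_def)
    obtain L :: "complex set" where L: "circularly_chainable (top_of_set L)"
      "hereditarily_indecomposable (top_of_set L)" "top_of_set \<Psi> homeomorphic_space top_of_set L"
      using circle unfolding pseudo_circle_def by blast
    \<comment> \<open>\<open>pseudo_circle\<close> speaks of a homeomorphic planar copy
      \<open>L\<close>; both properties are carried back to \<Psi>.\<close>
    have circ: "circularly_chainable (top_of_set \<Psi>)" "hereditarily_indecomposable (top_of_set \<Psi>)"
      using L homeomorphic_circularly_chainable homeomorphic_hereditarily_indecomposable
        homeomorphic_space_sym by blast+
    have inj: "inj_on \<theta> (topspace N)" and surj: "\<theta> ` topspace N = M"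
      using homeomorphic_imp_injective_map[OF \<theta>] homeomorphic_imp_surjective_map[OF \<theta>] by auto
    have "subcontinuum (top_of_set M) (\<theta> ` K)" using subcontinuum_homeomorphic_image[OF \<theta> sub] .
    then have im: "\<theta> ` K \<subseteq> M" "compact (\<theta> ` K)" "connected (\<theta> ` K)" "\<theta> ` K \<noteq> {}"
      unfolding subcontinuum_top_of_set by auto
    have "\<theta> ` K \<noteq> M" using inj surj KN neN by (metis inj_on_image_eq_iff subset_refl)
    moreover have "\<nexists>x. \<theta> ` K = {x}"
    proof
      assume "\<exists>x. \<theta> ` K = {x}"
      then obtain x where x: "\<theta> ` K = {x}" by blast
      obtain y where "y \<in> K" using im(4) by blast
      then have "\<theta> y = x" using x by blast
      then have "\<theta> ` K = \<theta> ` {y}" using x by simp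
      then have "K = {y}" using inj KN \<open>y \<in> K\<close> by (metis inj_on_image_eq_iff insert_subset empty_subsetI subsetD)
      then show False using ns by blast
    qed
    ultimately have "pseudo_arc (top_of_set (\<theta> ` K))"
      by (rule pseudo_arc_proper_subcontinuum[OF circ(2,1) im])
    moreover have "subtopology N K homeomorphic_space top_of_set (\<theta> ` K)"
      using homeomorphic_map_imp_homeomorphic_space[OF homeomorphic_map_subtopology_image[OF \<theta> KN]]
      by (simp add: subtopology_subtopology Int_absorb1 im(1))
    moreover have "subtopology N K = subtopology (ps_space X h) K"
      using KN by (simp add: N_def subtopology_subtopology Int_absorb1)
    ultimately show ?thesis using homeomorphic_pseudo_arc homeomorphic_space_sym by metis
  qed
  moreover have "hereditarily_indecomposable N" if circle: "pseudo_circle (top_of_set \<Psi>)"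
  proof -
    have "hereditarily_indecomposable (top_of_set \<Psi>)"
      using circle homeomorphic_hereditarily_indecomposable homeomorphic_space_sym
      unfolding pseudo_circle_def by blast
    from hereditarily_indecomposable_suspension[OF this] show ?thesis
      using homeomorphic_hereditarily_indecomposable NM homeomorphic_space_sym by blast
  qed
  ultimately show ?thesis unfolding N_def by blast
qed

end
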